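(* Let $Q=[a_1,b_1]\times[a_2,b_2]\times[a_3,b_3]$ and $Q'=[a_1',b_1']\times[a_2',b_2']\times[a_3',b_3']$ be axis-parallel rectangular cuboids in $\mathbb{R}^3$ and let $n_1,n_2,n_3,m_1,m_2,m_3\in\mathbb{N}_0$. Consider the Newton potential \[ V=\iiint_Q\iiint_{Q'}\frac{x_1^{n_1}x_2^{n_2}x_3^{n_3}\,y_1^{m_1}y_2^{m_2}y_3^{m_3}\;dy_1dy_2dy_3\,dx_1dx_2dx_3}{\sqrt{(x_1-y_1)^2+(x_2-y_2)^2+(x_3-y_3)^2}} \] and the force components, for $j=1,2,3$, \[ F_j=\iiint_Q\iiint_{Q'}\frac{(x_j-y_j)\,x_1^{n_1}x_2^{n_2}x_3^{n_3}\,y_1^{m_1}y_2^{m_2}y_3^{m_3}\;dy_1dy_2dy_3\,dx_1dx_2dx_3}{\left((x_1-y_1)^2+(x_2-y_2)^2+(x_3-y_3)^2\right)^{3/2}}. \] Then $V$ and each $F_j$ are linear combinations of terms of the form \[ \frac{1}{\rho_\delta},\qquad \operatorname{arctanh}\frac{\delta_3}{\rho_\delta},\qquad \arctan\frac{\delta_2\delta_3}{\delta_1\rho_\delta},\qquad \rho_\delta=\sqrt{\delta_1^2+\delta_2^2+\delta_3^2}, \] where $(\delta_1,\delta_2,\delta_3)$ satisfies $\delta_1\neq0$ and is, up to a permutation, the component-wise difference $(c_1-c_1',c_2-c_2',c_3-c_3')$ between the coordinates of a vertex $(c_1,c_2,c_3)$ of $Q$ (so $c_i\in\{a_i,b_i\}$)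 and a vertex $(c_1',c_2',c_3')$ of $Q'$ (so $c_i'\in\{a_i',b_i'\}$); the coefficients of these terms are polynomials with rational coefficients in the integral bounds $a_i,b_i,a_i',b_i'$.
   Context: $\mathbb{N}_0=\{0,1,2,\dots\}$. *)

theory Defs
  imports "HOL-Analysis.Analysis"
begin

inductive_set qpoly :: "(('v \<Rightarrow> real) \<Rightarrow> real) set" where
  qp_const: "c \<in> \<rat> \<Longrightarrow> (\<lambda>_. c) \<in> qpoly"
| qp_var: "(\<lambda>v. v i) \<in> qpoly"
| qp_add: "p \<in> qpoly \<Longrightarrow> q \<in> qpoly \<Longrightarrow> (\<lambda>v. p v + q v) \<in> qpoly"
| qp_mult: "p \<in> qpoly \<Longrightarrow> q \<in> qpoly \<Longrightarrow> (\<lambda>v. p v * q v) \<in> qpoly"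

definition crd :: "real \<times> real \<times> real \<Rightarrow> nat \<Rightarrow> real" where
  "crd x i = (if i = 1 then fst x else if i = 2 then fst (snd x)
              else if i = 3 then snd (snd x) else 0)"

definition cuboid :: "(nat \<Rightarrow> real) \<Rightarrow> (nat \<Rightarrow> real) \<Rightarrow> (real \<times> real \<times> real) set" where
  "cuboid a b = {a 1..b 1} \<times> {a 2..b 2} \<times> {a 3..b 3}"

definition mono3 :: "real \<times> real \<times> real \<Rightarrow> (nat \<Rightarrow> nat) \<Rightarrow> real" where
  "mono3 x n = crd x 1 ^ n 1 * crd x 2 ^ n 2 * crd x 3 ^ n 3"

definition sqdist3 :: "real \<times> real \<times> real \<Rightarrow> real \<times> real \<times> real \<Rightarrow> real" where
  "sqdist3 x y = (crd x 1 - crd y 1)^2 + (crd x 2 - crd y 2)^2 + (crd x 3 - crd y 3)^2"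

definition Vpot :: "(nat \<Rightarrow> real) \<Rightarrow> (nat \<Rightarrow> real) \<Rightarrow> (nat \<Rightarrow> real) \<Rightarrow> (nat \<Rightarrow> real)
                     \<Rightarrow> (nat \<Rightarrow> nat) \<Rightarrow> (nat \<Rightarrow> nat) \<Rightarrow> real" where
  "Vpot a b a' b' n m =
     (LINT x:cuboid a b|lborel. LINT y:cuboid a' b'|lborel.
        mono3 x n * mono3 y m / sqrt (sqdist3 x y))"

definition Fforce :: "nat \<Rightarrow> (nat \<Rightarrow> real) \<Rightarrow> (nat \<Rightarrow> real) \<Rightarrow> (nat \<Rightarrow> real) \<Rightarrow> (nat \<Rightarrow> real)
                     \<Rightarrow> (nat \<Rightarrow> nat) \<Rightarrow> (nat \<Rightarrow> nat) \<Rightarrow> real" where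
  "Fforce j a b a' b' n m =
     (LINT x:cuboid a b|lborel. LINT y:cuboid a' b'|lborel.
        (crd x j - crd y j) * mono3 x n * mono3 y m / (sqdist3 x y) powr (3/2))"

definition vtx :: "(nat \<Rightarrow> real) \<Rightarrow> (nat \<Rightarrow> real) \<Rightarrow> nat set \<Rightarrow> nat \<Rightarrow> real" where
  "vtx a b S i = (if i \<in> S then b i else a i)"

definition delta :: "(nat \<Rightarrow> real) \<Rightarrow> (nat \<Rightarrow> real) \<Rightarrow> (nat \<Rightarrow> real) \<Rightarrow> (nat \<Rightarrow> real)
                     \<Rightarrow> (nat \<Rightarrow> nat) \<Rightarrow> nat set \<Rightarrow> nat set \<Rightarrow> nat \<Rightarrow> real" where
  "delta a b a' b' \<sigma> S S' k = vtx a b S (\<sigma> k) - vtx a' b' S' (\<sigma> k)"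

definition rho :: "(nat \<Rightarrow> real) \<Rightarrow> real" where
  "rho d = sqrt (d 1 ^ 2 + d 2 ^ 2 + d 3 ^ 2)"

definition basic_term :: "nat \<Rightarrow> (nat \<Rightarrow> real) \<Rightarrow> real" where
  "basic_term k d =
     (if k = 0 then 1 / rho d
      else if k = 1 then artanh (d 3 / rho d)
      else arctan (d 2 * d 3 / (d 1 * rho d)))"

text \<open>The bounds as an assignment to the polynomial variables:
  (0,i) = a i, (1,i) = b i, (2,i) = a' i, (3,i) = b' i.\<close>
definition bounds_env :: "(nat \<Rightarrow> real) \<Rightarrow> (nat \<Rightarrow> real) \<Rightarrow> (nat \<Rightarrow> real) \<Rightarrow> (nat \<Rightarrow> real)
                          \<Rightarrow> nat \<times> nat \<Rightarrow> real" where
  "bounds_env a b a' b' v =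
     (if fst v = 0 then a (snd v) else if fst v = 1 then b (snd v)
      else if fst v = 2 then a' (snd v) else b' (snd v))"

definition lincomb ::
  "(nat \<Rightarrow> (nat \<Rightarrow> nat) \<Rightarrow> nat set \<Rightarrow> nat set \<Rightarrow> ((nat \<times> nat \<Rightarrow> real) \<Rightarrow> real))
   \<Rightarrow> (nat \<Rightarrow> real) \<Rightarrow> (nat \<Rightarrow> real) \<Rightarrow> (nat \<Rightarrow> real) \<Rightarrow> (nat \<Rightarrow> real) \<Rightarrow> real" where
  "lincomb coef a b a' b' =
     (\<Sum>k\<in>{0,1,2}. \<Sum>\<sigma>\<in>{\<sigma>. \<sigma> permutes {1,2,3}}. \<Sum>S\<in>Pow {1,2,3}. \<Sum>S'\<in>Pow {1,2,3}.
        (if delta a b a' b' \<sigma> S S' 1 \<noteq> 0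
         then coef k \<sigma> S S' (bounds_env a b a' b') * basic_term k (delta a b a' b' \<sigma> S S')
         else 0))"

end

(*
  Up to sign, integrating a polynomial times a function of the difference d = x - y in any of
  x_1,...,y_3 amounts to finding an antiderivative in the corresponding d_i with polynomial
  coefficients. The module M spanned over the rational polynomials by rho, d_i artanh(d_k / rho) and
  d_i arctan(d_j d_k / (d_i rho)) is closed under these antiderivatives; the closure reduces to the
  functions q_m = x^m y / (rho (x^2 + z^2)), which satisfy q_{m+2} = x^m y / rho - z^2 q_m, where
  z q_0 and q_1 are the x-derivatives of arctan(x y / (z rho)) and -artanh(y / rho).

  The generators of M are continuous on the whole space, the vanishing factor d_i compensating the
  singularity; this is why terms with d_1 = 0 may be dropped. For almost every x no difference to a
  vertex of Q' vanishes, and three integrations in y turn either kernel into vertex values of an element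
  of M, if for the force F_j the direction j is integrated first. The three integrations in x stay in M.
  Finally rho = (d_1^2 + d_2^2 + d_3^2) / rho.
*)
theory Submission
  imports Defs
begin

section \<open>Modules over rational polynomials and antiderivatives\<close>

text \<open>The cuboids may touch or overlap, so the kernel can be singular inside the domain and
  the antiderivatives are not differentiable everywhere. Derivatives are therefore asserted only
  where all three differences are nonzero, and the fundamental theorem is used in the form that
  admits finitely many exceptional points but demands a continuous antiderivative.
  \<open>1 / rho d\<close> is discontinuous at the origin and a bare
  \<open>artanh (d j / rho d)\<close> on an axis; generic x and almost every y keep the lines of
  integration off the axes during the three integrations in y. After these the integrand is
  continuous everywhere and no genericity remains to be arranged. The force starts with direction j
  because \<open>d j / rho d ^ 3\<close> integrates there to \<open>- 1 / rho d\<close>, whereas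
  another direction would put the denominator \<open>d j ^ 2 + d k ^ 2\<close> into the
  coefficients, which have to stay polynomial. The coefficients may depend on the exponents but not
  on the bounds; hence every antiderivative is chosen before the cuboids are.\<close>

lemma qpoly_diff: "p \<in> qpoly \<Longrightarrow> q \<in> qpoly \<Longrightarrow> (\<lambda>v. p v - q v) \<in> qpoly"
  using qp_add[of p "\<lambda>v. - 1 * q v"] qp_mult[OF qp_const[of "- 1"], of q] by simp

lemma qpoly_power: "p \<in> qpoly \<Longrightarrow> (\<lambda>v. p v ^ k) \<in> qpoly"
  by (induction k) (auto intro: qp_const qp_mult)

lemmas qpoly_intros = qp_const qp_var qp_add qp_mult qpoly_diff qpoly_power

lemma qpoly_subst:
  assumes "p \<in> qpoly" "\<And>i. (\<lambda>u. s u i) \<in> qpoly"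
  shows "(\<lambda>u. p (s u)) \<in> qpoly"
  using assms(1) by induction (auto intro: qpoly_intros assms(2))

lemma continuous_on_qpoly: "p \<in> qpoly \<Longrightarrow> continuous_on A p"
proof (induction rule: qpoly.induct)
  case (qp_var i)
  show ?case by (rule continuous_on_subset[OF continuous_on_product_coordinates]) simp
qed (auto intro: continuous_intros)

definition indep :: "(('v \<Rightarrow> real) \<Rightarrow> real) \<Rightarrow> 'v \<Rightarrow> bool" where
  "indep c w \<longleftrightarrow> (\<forall>v t. c (v(w := t)) = c v)"

text \<open>The coefficients are polynomials in all variables, including the one integrated over, so
  closure under antiderivatives reduces to a polynomial times a single generator.\<close>

inductive_set qspan :: "(('v \<Rightarrow> real) \<Rightarrow> real) set \<Rightarrow> (('v \<Rightarrow> real) \<Rightarrow> real) set"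
  for B where
  qs_gen: "c \<in> qpoly \<Longrightarrow> g \<in> B \<Longrightarrow> (\<lambda>v. c v * g v) \<in> qspan B"
| qs_add: "f \<in> qspan B \<Longrightarrow> g \<in> qspan B \<Longrightarrow> (\<lambda>v. f v + g v) \<in> qspan B"

lemma qspan_base: "g \<in> B \<Longrightarrow> g \<in> qspan B"
  using qs_gen[OF qp_const[of 1], of g B] by simp

lemma qspan_mult: "f \<in> qspan B \<Longrightarrow> p \<in> qpoly \<Longrightarrow> (\<lambda>v. p v * f v) \<in> qspan B"
proof (induction rule: qspan.induct)
  case (qs_gen c g)
  then show ?case
    using qspan.qs_gen[of "\<lambda>v. p v * c v" g B] by (auto intro: qpoly_intros simp: mult.assoc)
next
  case (qs_add f g)
  then show ?case
    using qspan.qs_add by (auto simp: distrib_left)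
qed

lemma qspan_mono: "f \<in> qspan B \<Longrightarrow> B \<subseteq> C \<Longrightarrow> f \<in> qspan C"
  by (induction rule: qspan.induct) (auto intro: qspan.intros)

lemma continuous_on_qspan:
  assumes "f \<in> qspan B" "\<And>g. g \<in> B \<Longrightarrow> continuous_on A g"
  shows "continuous_on A f"
  using assms(1)
proof induction
  case (qs_gen c g)
  then show ?case by (intro continuous_on_mult continuous_on_qpoly assms(2))
next
  case (qs_add f g)
  then show ?case by (intro continuous_on_add)
qed

text \<open>Nothing is asked outside \<open>R\<close>. There the formulas may pass through
  \<open>x / 0 = 0\<close>; continuity is established separately.\<close>

definition antider ::
  "('v \<Rightarrow> real) set \<Rightarrow> 'v \<Rightarrow> (('v \<Rightarrow> real) \<Rightarrow> real) \<Rightarrow> (('v \<Rightarrow> real) \<Rightarrow> real) \<Rightarrow> bool" where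
  "antider R w F f \<longleftrightarrow> (\<forall>v\<in>R. ((\<lambda>t. F (v(w := t))) has_real_derivative f v) (at (v w)))"

definition antiderivable ::
  "('v \<Rightarrow> real) set \<Rightarrow> 'v \<Rightarrow> (('v \<Rightarrow> real) \<Rightarrow> real) set \<Rightarrow> (('v \<Rightarrow> real) \<Rightarrow> real) \<Rightarrow> bool" where
  "antiderivable R w B f \<longleftrightarrow> (\<exists>F\<in>qspan B. antider R w F f)"

lemma antider_add: "antider R w F f \<Longrightarrow> antider R w G g \<Longrightarrow> antider R w (\<lambda>v. F v + G v) (\<lambda>v. f v + g v)"
  by (auto simp: antider_def intro: DERIV_add)

lemma antider_mult: "indep c w \<Longrightarrow> antider R w F f \<Longrightarrow> antider R w (\<lambda>v. c v * F v) (\<lambda>v. c v * f v)"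
proof -
  assume c: "indep c w" and F: "antider R w F f"
  show ?thesis
    unfolding antider_def
  proof
    fix v assume "v \<in> R"
    then have "((\<lambda>t. c v * F (v(w := t))) has_real_derivative c v * f v) (at (v w))"
      using F by (intro DERIV_cmult) (simp add: antider_def)
    moreover have "c (v(w := t)) = c v" for t
      using c[unfolded indep_def, THEN spec, THEN spec] .
    ultimately show "((\<lambda>t. c (v(w := t)) * F (v(w := t))) has_real_derivative c v * f v) (at (v w))"
      by (simp only:)
  qed
qed

lemma antiderivable_add:
  "antiderivable R w B f \<Longrightarrow> antiderivable R w B g \<Longrightarrow> antiderivable R w B (\<lambda>v. f v + g v)"
proof -
  assume "antiderivable R w B f" "antiderivable R w B g"
  then obtain F G where "F \<in> qspan B" "antider R w F f" "G \<in> qspan B" "antider R w G g"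
    by (auto simp: antiderivable_def)
  then have "(\<lambda>v. F v + G v) \<in> qspan B" "antider R w (\<lambda>v. F v + G v) (\<lambda>v. f v + g v)"
    using qs_add antider_add by auto
  then show ?thesis unfolding antiderivable_def by - (rule bexI)
qed

lemma antiderivable_mult:
  "c \<in> qpoly \<Longrightarrow> indep c w \<Longrightarrow> antiderivable R w B f \<Longrightarrow> antiderivable R w B (\<lambda>v. c v * f v)"
proof -
  assume c: "c \<in> qpoly" "indep c w" and "antiderivable R w B f"
  then obtain F where "F \<in> qspan B" "antider R w F f"
    by (auto simp: antiderivable_def)
  then have "(\<lambda>v. c v * F v) \<in> qspan B" "antider R w (\<lambda>v. c v * F v) (\<lambda>v. c v * f v)"
    using qspan_mult[OF _ c(1)] antider_mult[OF c(2)] by auto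
  then show ?thesis unfolding antiderivable_def by - (rule bexI)
qed

lemma antiderivable_mono: "antiderivable R w B f \<Longrightarrow> B \<subseteq> C \<Longrightarrow> antiderivable R w C f"
  unfolding antiderivable_def using qspan_mono by blast

text \<open>Subtracting the derivative of a known element leaves the simpler \<open>f2\<close>. The
  equation is required on \<open>R\<close> only, where the cancellations of \<open>rho\<close>
  behind it are legitimate.\<close>

lemma antiderivable_by:
  assumes "F \<in> qspan B" "antider R w F f1" "antiderivable R w B f2"
    "\<And>v. v \<in> R \<Longrightarrow> f v = f1 v + f2 v"
  shows "antiderivable R w B f"
proof -
  obtain G where G: "G \<in> qspan B" "antider R w G f2"
    using assms(3) by (auto simp: antiderivable_def)
  have "antider R w (\<lambda>v. F v + G v) f"
    using antider_add[OF assms(2) G(2)] assms(4) by (simp add: antider_def)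
  moreover have "(\<lambda>v. F v + G v) \<in> qspan B" using assms(1) G(1) by (rule qs_add)
  ultimately show ?thesis
    unfolding antiderivable_def by - (rule bexI)
qed

lemma antiderivable_cong:
  "antiderivable R w B f2 \<Longrightarrow> (\<And>v. v \<in> R \<Longrightarrow> f v = f2 v) \<Longrightarrow> antiderivable R w B f"
  unfolding antiderivable_def antider_def by simp

lemma antiderivable_direct:
  "F \<in> qspan B \<Longrightarrow> antider R w F f \<Longrightarrow> antiderivable R w B f"
  unfolding antiderivable_def by - (rule bexI)

section \<open>Derivatives of the basic terms\<close>

lemma abs_div_sqrt_less_1:
  fixes x y z :: real
  assumes "y \<noteq> 0 \<or> z \<noteq> 0"
  shows "\<bar>x / sqrt (x^2 + y^2 + z^2)\<bar> < 1"
proof -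
  have "0 < y^2 + z^2"
    using assms by (metis sum_power2_gt_zero_iff)
  then have "x^2 < x^2 + y^2 + z^2" by simp
  then have *: "\<bar>x\<bar> < sqrt (x^2 + y^2 + z^2)"
    by (metis real_sqrt_abs real_sqrt_less_iff)
  then have "0 < sqrt (x^2 + y^2 + z^2)" by linarith
  then show ?thesis
    using * by (simp only: abs_divide abs_of_pos pos_divide_less_eq mult_1)
qed

lemma one_minus_div_power2: "(b::real) \<noteq> 0 \<Longrightarrow> 1 - (a / b)^2 = (b^2 - a^2) / b^2"
  by (simp add: power_divide diff_divide_distrib)

lemma one_plus_div_power2: "(b::real) \<noteq> 0 \<Longrightarrow> 1 + (a / b)^2 = (b^2 + a^2) / b^2"
  by (simp add: power_divide add_divide_distrib)

lemma sqrt_sum_squares_pos: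
  fixes x y z :: real
  assumes "x \<noteq> 0 \<or> y \<noteq> 0 \<or> z \<noteq> 0"
  shows "0 < x^2 + y^2 + z^2"
  using assms by (metis add_nonneg_pos add_pos_nonneg zero_le_power2 zero_less_power2 add.assoc)

lemma deriv_r:
  fixes x y z :: real
  assumes "x \<noteq> 0 \<or> y \<noteq> 0 \<or> z \<noteq> 0"
  shows "((\<lambda>x. sqrt (x^2 + y^2 + z^2)) has_real_derivative x / sqrt (x^2 + y^2 + z^2)) (at x)"
  using sqrt_sum_squares_pos[OF assms]
  by (auto intro!: derivative_eq_intros simp: field_simps)

lemma deriv_artanh_same:
  fixes x y z :: real
  assumes "y \<noteq> 0 \<or> z \<noteq> 0"
  shows "((\<lambda>x. artanh (x / sqrt (x^2 + y^2 + z^2))) has_real_derivative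
           1 / sqrt (x^2 + y^2 + z^2)) (at x)"
proof -
  define r where "r = sqrt (x^2 + y^2 + z^2)"
  have p: "0 < x^2 + y^2 + z^2" using assms sqrt_sum_squares_pos by blast
  then have r: "0 < r" "r^2 = x^2 + y^2 + z^2" by (auto simp: r_def)
  have yz: "0 < y^2 + z^2" using assms by (metis sum_power2_gt_zero_iff)
  have d: "((\<lambda>x. x / sqrt (x^2 + y^2 + z^2)) has_real_derivative (r - x * (x / r)) / (r * r)) (at x)"
    using r(1) by (auto intro!: derivative_eq_intros deriv_r[THEN DERIV_cong] assms[THEN disjI2]
        simp: r_def[symmetric])
  have "\<bar>x / r\<bar> < 1" unfolding r_def by (rule abs_div_sqrt_less_1[OF assms])
  then have "(artanh has_real_derivative 1 / (1 - (x / r)^2)) (at (x / r))"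
    by (intro artanh_real_has_field_derivative) auto
  from DERIV_chain2[OF this[unfolded r_def] d]
  have "((\<lambda>x. artanh (x / sqrt (x^2 + y^2 + z^2))) has_real_derivative
     1 / (1 - (x / r)^2) * ((r - x * (x / r)) / (r * r))) (at x)"
    by (simp add: r_def)
  moreover have e1: "1 - (x / r)^2 = (y^2 + z^2) / r^2"
    using r by (simp add: one_minus_div_power2)
  have e2: "(r - x * (x / r)) / (r * r) = (y^2 + z^2) / r^3"
    using r by (simp add: field_simps power2_eq_square power3_eq_cube)
  have "1 / (A / r^2) * (A / r^3) = 1 / r" if "A > 0" for A
    using r(1) that by (simp add: power2_eq_square power3_eq_cube)
  from this[OF yz] have "1 / (1 - (x / r)^2) * ((r - x * (x / r)) / (r * r)) = 1 / r"
    unfolding e1 e2 .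
  ultimately show ?thesis by (simp only: r_def)
qed

lemma deriv_artanh_other:
  fixes x y z :: real
  assumes "x \<noteq> 0 \<or> z \<noteq> 0"
  shows "((\<lambda>x. artanh (y / sqrt (x^2 + y^2 + z^2))) has_real_derivative
           - (x * y / (sqrt (x^2 + y^2 + z^2) * (x^2 + z^2)))) (at x)"
proof -
  define r where "r = sqrt (x^2 + y^2 + z^2)"
  have p: "0 < x^2 + y^2 + z^2" using assms sqrt_sum_squares_pos by blast
  then have r: "0 < r" "r^2 = x^2 + y^2 + z^2" by (auto simp: r_def)
  have xz: "0 < x^2 + z^2" using assms by (metis sum_power2_gt_zero_iff)
  have d: "((\<lambda>x. y / sqrt (x^2 + y^2 + z^2)) has_real_derivative - (y * (x / r)) / (r * r)) (at x)"
    using r(1) assms by (auto intro!: derivative_eq_intros deriv_r[THEN DERIV_cong]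
        simp: r_def[symmetric])
  have "\<bar>y / r\<bar> < 1" unfolding r_def
    using abs_div_sqrt_less_1[OF assms, of y] by (simp add: ac_simps)
  then have "(artanh has_real_derivative 1 / (1 - (y / r)^2)) (at (y / r))"
    by (intro artanh_real_has_field_derivative) auto
  from DERIV_chain2[OF this[unfolded r_def] d]
  have "((\<lambda>x. artanh (y / sqrt (x^2 + y^2 + z^2))) has_real_derivative
     1 / (1 - (y / r)^2) * (- (y * (x / r)) / (r * r))) (at x)"
    by (simp add: r_def)
  moreover have e1: "1 - (y / r)^2 = (x^2 + z^2) / r^2"
    using r by (simp add: one_minus_div_power2)
  have "1 / (A / r^2) * (- (y * (x / r)) / (r * r)) = - (x * y / (r * A))" if "A > 0" for A
    using r(1) that by (simp add: field_simps power2_eq_square)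
  from this[OF xz] have "1 / (1 - (y / r)^2) * (- (y * (x / r)) / (r * r)) = - (x * y / (r * (x^2 + z^2)))"
    unfolding e1 .
  ultimately show ?thesis by (simp only: r_def)
qed

lemma deriv_arctan_other:
  fixes x y z :: real
  assumes "z \<noteq> 0"
  shows "((\<lambda>x. arctan (x * y / (z * sqrt (x^2 + y^2 + z^2)))) has_real_derivative
           z * y / (sqrt (x^2 + y^2 + z^2) * (x^2 + z^2))) (at x)"
proof -
  define r where "r = sqrt (x^2 + y^2 + z^2)"
  have p: "0 < x^2 + y^2 + z^2" using assms sqrt_sum_squares_pos by blast
  then have r: "0 < r" "r^2 = x^2 + y^2 + z^2" by (auto simp: r_def)
  have xz: "0 < x^2 + z^2" using assms by (metis sum_power2_gt_zero_iff)
  have yz: "0 < y^2 + z^2" using assms by (metis sum_power2_gt_zero_iff)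
  have d: "((\<lambda>x. x * y / (z * sqrt (x^2 + y^2 + z^2))) has_real_derivative
      (y * (z * r) - x * y * (z * (x / r))) / ((z * r) * (z * r))) (at x)"
    using r(1) assms by (auto intro!: derivative_eq_intros deriv_r[THEN DERIV_cong]
        simp: r_def[symmetric])
  from DERIV_chain2[OF DERIV_arctan d]
  have D: "((\<lambda>x. arctan (x * y / (z * sqrt (x^2 + y^2 + z^2)))) has_real_derivative
     inverse (1 + (x * y / (z * r))^2) * ((y * (z * r) - x * y * (z * (x / r))) / ((z * r) * (z * r)))) (at x)"
    by (simp add: r_def)
  \<comment> \<open>This factorisation gives the denominator of the arctan derivative a factor
    \<open>y^2 + z^2\<close> that cancels against the inner derivative.\<close>
  have "z^2 * r^2 + x^2 * y^2 = (x^2 + z^2) * (y^2 + z^2)"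
    unfolding r by (simp add: algebra_simps power2_eq_square)
  then have a: "1 + (x * y / (z * r))^2 = (x^2 + z^2) * (y^2 + z^2) / (z^2 * r^2)"
    using r(1) assms by (simp add: one_plus_div_power2 power_mult_distrib)
  have "y * (z * r) - x * y * (z * (x / r)) = y * z * (r^2 - x^2) / r"
    using r(1) by (simp add: field_simps power2_eq_square)
  then have b: "y * (z * r) - x * y * (z * (x / r)) = y * z * (y^2 + z^2) / r"
    using r(2) by simp
  have "inverse (A * B / (z^2 * r^2)) * (y * z * B / r / ((z * r) * (z * r))) = z * y / (r * A)"
    if "A > 0" "B > 0" for A B
    using r(1) that assms by (simp add: field_simps power2_eq_square)
  from this[OF xz yz] have "inverse (1 + (x * y / (z * r))^2) * ((y * (z * r) - x * y * (z * (x / r))) / ((z * r) * (z * r)))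
     = z * y / (r * (x^2 + z^2))"
    unfolding a b .
  with D show ?thesis by (simp only: r_def)
qed

lemma deriv_arctan_same:
  fixes x y z :: real
  assumes "x \<noteq> 0"
  shows "((\<lambda>x. arctan (y * z / (x * sqrt (x^2 + y^2 + z^2)))) has_real_derivative
           - (y * z / (sqrt (x^2 + y^2 + z^2) * (x^2 + y^2)) + y * z / (sqrt (x^2 + y^2 + z^2) * (x^2 + z^2)))) (at x)"
proof -
  define r where "r = sqrt (x^2 + y^2 + z^2)"
  have p: "0 < x^2 + y^2 + z^2" using assms sqrt_sum_squares_pos by blast
  then have r: "0 < r" "r^2 = x^2 + y^2 + z^2" by (auto simp: r_def)
  have xz: "0 < x^2 + z^2" using assms by (metis sum_power2_gt_zero_iff)
  have xy: "0 < x^2 + y^2" using assms by (metis sum_power2_gt_zero_iff)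
  have d: "((\<lambda>x. y * z / (x * sqrt (x^2 + y^2 + z^2))) has_real_derivative
      - (y * z * (r + x * (x / r))) / ((x * r) * (x * r))) (at x)"
    using r(1) assms by (auto intro!: derivative_eq_intros deriv_r[THEN DERIV_cong]
        simp: r_def[symmetric])
  from DERIV_chain2[OF DERIV_arctan d]
  have D: "((\<lambda>x. arctan (y * z / (x * sqrt (x^2 + y^2 + z^2)))) has_real_derivative
     inverse (1 + (y * z / (x * r))^2) * (- (y * z * (r + x * (x / r))) / ((x * r) * (x * r)))) (at x)"
    by (simp add: r_def)
  have "x^2 * r^2 + y^2 * z^2 = (x^2 + y^2) * (x^2 + z^2)"
    unfolding r by (simp add: algebra_simps power2_eq_square)
  then have a: "1 + (y * z / (x * r))^2 = (x^2 + y^2) * (x^2 + z^2) / (x^2 * r^2)"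
    using r(1) assms by (simp add: one_plus_div_power2 power_mult_distrib)
  have "y * z * (r + x * (x / r)) = y * z * (r^2 + x^2) / r"
    using r(1) by (simp add: field_simps power2_eq_square)
  \<comment> \<open>The numerator is the sum of the two factors of the denominator, so the fraction
    splits into the two fractions of the claim.\<close>
  then have b: "y * z * (r + x * (x / r)) = y * z * ((x^2 + y^2) + (x^2 + z^2)) / r"
    using r(2) by (simp add: ac_simps)
  have "inverse (A * B / (x^2 * r^2)) * (- (y * z * (A + B) / r) / ((x * r) * (x * r)))
      = - (y * z / (r * A) + y * z / (r * B))"
    if "A > 0" "B > 0" for A B
  proof -
    have "inverse (A * B / (x^2 * r^2)) * (- (y * z * (A + B) / r) / ((x * r) * (x * r)))
        = - (y * z * (A + B) / (r * (A * B)))"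
      using r(1) that assms by (simp add: power2_eq_square mult.commute mult.left_commute)
    also have "\<dots> = - (y * z / (r * A) + y * z / (r * B))"
      using r(1) that by (simp add: field_simps)
    finally show ?thesis .
  qed
  from this[OF xy xz] have "inverse (1 + (y * z / (x * r))^2) * (- (y * z * (r + x * (x / r))) / ((x * r) * (x * r)))
     = - (y * z / (r * (x^2 + y^2)) + y * z / (r * (x^2 + z^2)))"
    unfolding a b .
  with D show ?thesis by (simp only: r_def)
qed

section \<open>Closure of the module under antiderivatives\<close>

definition nonvanishing :: "(nat \<Rightarrow> real) set" where
  "nonvanishing = {d. \<forall>i\<in>{1,2,3}. d i \<noteq> 0}"

text \<open>As a set equation it forces the indices to be distinct and is invariant under
  reordering; one statement then covers all six roles of the coordinates.\<close>

definition perm3 :: "nat \<Rightarrow> nat \<Rightarrow> nat \<Rightarrow> bool" where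
  "perm3 i j k \<longleftrightarrow> {i, j, k} = {1, 2, 3}"

lemma perm3_cases:
  assumes "perm3 i j k"
  obtains "i = 1" "j = 2" "k = 3" | "i = 1" "j = 3" "k = 2" | "i = 2" "j = 1" "k = 3"
    | "i = 2" "j = 3" "k = 1" | "i = 3" "j = 1" "k = 2" | "i = 3" "j = 2" "k = 1"
proof -
  have ijk: "i \<in> {1,2,3}" "j \<in> {1,2,3}" "k \<in> {1,2,3}"
    and m: "1 \<in> {i,j,k}" "2 \<in> {i,j,k}" "3 \<in> {i,j,k}"
    using assms unfolding perm3_def by blast+
  from ijk show ?thesis
    by (elim insertE emptyE) (use m that in simp_all)
qed

lemma perm3_swap: "perm3 i j k \<Longrightarrow> perm3 i k j" "perm3 i j k \<Longrightarrow> perm3 j i k" "perm3 i j k \<Longrightarrow> perm3 k j i"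
    "perm3 i j k \<Longrightarrow> perm3 j k i" "perm3 i j k \<Longrightarrow> perm3 k i j"
  unfolding perm3_def by auto

lemma perm3_distinct: "perm3 i j k \<Longrightarrow> i \<noteq> j \<and> i \<noteq> k \<and> j \<noteq> k \<and> j \<noteq> i \<and> k \<noteq> i \<and> k \<noteq> j"
  by (erule perm3_cases) auto

lemma rho_perm3: "perm3 i j k \<Longrightarrow> rho d = sqrt (d i ^ 2 + d j ^ 2 + d k ^ 2)"
  by (erule perm3_cases) (simp_all add: rho_def ac_simps)

lemma nonvanishing_perm3: "perm3 i j k \<Longrightarrow> d \<in> nonvanishing \<longleftrightarrow> d i \<noteq> 0 \<and> d j \<noteq> 0 \<and> d k \<noteq> 0"
  by (erule perm3_cases) (auto simp: nonvanishing_def)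

lemma rho_pos: "d \<in> nonvanishing \<Longrightarrow> 0 < rho d"
  using sqrt_sum_squares_pos[of "d 1" "d 2" "d 3"] by (simp add: nonvanishing_def rho_def)

lemma antider_prod:
  assumes "antider R w F f" "antider R w G g"
  shows "antider R w (\<lambda>v. F v * G v) (\<lambda>v. f v * G v + F v * g v)"
  unfolding antider_def
proof
  fix v assume "v \<in> R"
  with assms have "((\<lambda>t. F (v(w := t))) has_real_derivative f v) (at (v w))"
    "((\<lambda>t. G (v(w := t))) has_real_derivative g v) (at (v w))"
    by (auto simp: antider_def)
  from DERIV_mult[OF this]
  show "((\<lambda>t. F (v(w := t)) * G (v(w := t))) has_real_derivative f v * G v + F v * g v) (at (v w))"
    by (simp add: mult.commute)
qed

lemma antider_power: "antider R w (\<lambda>v. v w ^ Suc m) (\<lambda>v. real (Suc m) * v w ^ m)"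
  unfolding antider_def using DERIV_pow[of "Suc m"] by simp

lemma indep_intros:
  "indep (\<lambda>_. c) w" "i \<noteq> w \<Longrightarrow> indep (\<lambda>v. v i) w"
  "indep f w \<Longrightarrow> indep g w \<Longrightarrow> indep (\<lambda>v. f v + g v) w"
  "indep f w \<Longrightarrow> indep g w \<Longrightarrow> indep (\<lambda>v. f v * g v) w"
  "indep f w \<Longrightarrow> indep (\<lambda>v. f v ^ n) w"
  by (auto simp: indep_def)

text \<open>\<open>x^m G = ((x^(m+1) G)' - x^(m+1) g) / (m+1)\<close>. The power
  \<open>x^(m+1)\<close> supplies the factor that a bare artanh or arctan needs to lie in the
  module, and it raises the power of x in the remaining integrand.\<close>

lemma antiderivable_by_parts:
  assumes "antider R i G g" "(\<lambda>v. v i ^ Suc m * G v) \<in> qspan B"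
    "antiderivable R i B (\<lambda>v. v i ^ Suc m * g v)"
  shows "antiderivable R i B (\<lambda>v. v i ^ m * G v)"
proof (rule antiderivable_by)
  define c :: real where "c = 1 / real (Suc m)"
  have c: "c \<in> \<rat>" "- c \<in> \<rat>" by (auto simp: c_def)
  show "(\<lambda>v. c * (v i ^ Suc m * G v)) \<in> qspan B"
    by (rule qspan_mult[OF assms(2) qp_const[OF c(1)]])
  show "antider R i (\<lambda>v. c * (v i ^ Suc m * G v))
         (\<lambda>v. c * ((real (Suc m) * v i ^ m) * G v + v i ^ Suc m * g v))"
    by (intro antider_mult[OF indep_intros(1)] antider_prod[OF antider_power assms(1)])
  show "antiderivable R i B (\<lambda>v. - c * (v i ^ Suc m * g v))"
    by (intro antiderivable_mult[OF qp_const[OF c(2)] indep_intros(1)] assms(3))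
  show "v i ^ m * G v = c * ((real (Suc m) * v i ^ m) * G v + v i ^ Suc m * g v) + - c * (v i ^ Suc m * g v)" for v
  proof -
    have "c * real (Suc m) = 1" by (simp add: c_def)
    then have "c * ((real (Suc m) * v i ^ m) * G v) = v i ^ m * G v"
      by (metis mult.assoc mult.left_neutral)
    then show ?thesis by (simp only: distrib_left)
  qed
qed

text \<open>Either of the two coordinates other than \<open>d k\<close> may multiply
  \<open>artanh (d k / rho d)\<close>; both kinds arise.\<close>

definition Mgen :: "((nat \<Rightarrow> real) \<Rightarrow> real) set" where
  "Mgen = {rho} \<union> {\<lambda>d. d i * artanh (d k / rho d) | i j k. perm3 i j k}
     \<union> {\<lambda>d. d i * arctan (d j * d k / (d i * rho d)) | i j k. perm3 i j k}"

lemma MgenI: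
  "rho \<in> Mgen"
  "perm3 i j k \<Longrightarrow> (\<lambda>d. d i * artanh (d j / rho d)) \<in> Mgen"
  "perm3 i j k \<Longrightarrow> (\<lambda>d. d i * arctan (d j * d k / (d i * rho d))) \<in> Mgen"
  unfolding Mgen_def using perm3_swap by blast+

lemma rho_upd: "perm3 i j k \<Longrightarrow> rho (d(i := t)) = sqrt (t ^ 2 + d j ^ 2 + d k ^ 2)"
  using rho_perm3[of i j k "d(i := t)"] perm3_distinct[of i j k] by simp

lemma power_div_sum_squares:
  fixes x y z r :: real
  assumes "r \<noteq> 0" "x^2 + z^2 \<noteq> 0"
  shows "x ^ Suc (Suc m) * y / (r * (x^2 + z^2)) =
    y * (x ^ m / r) + - 1 * (z^2 * (x ^ m * y / (r * (x^2 + z^2))))"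
proof -
  define S where "S = x^2 + z^2"
  have "x ^ Suc (Suc m) = x ^ m * (S - z^2)"
    by (simp add: S_def power2_eq_square)
  moreover have "w * (S - c) * y / (r * S) = y * (w / r) + - 1 * (c * (w * y / (r * S)))" for w c
    using assms unfolding S_def[symmetric] by (simp add: field_simps)
  ultimately show ?thesis
    unfolding S_def[symmetric] by (simp only:)
qed

context
  fixes i j k :: nat
  assumes p: "perm3 i j k"
begin

lemmas perm3_orders = p perm3_swap[OF p]

lemma antider_rho: "antider nonvanishing i rho (\<lambda>d. d i / rho d)"
  using deriv_r perm3_distinct[OF p] by (simp add: antider_def rho_upd[OF p] rho_perm3[OF p] nonvanishing_perm3[OF p])

lemma antider_artanh_same:
  "antider nonvanishing i (\<lambda>d. artanh (d i / rho d)) (\<lambda>d. 1 / rho d)"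
  using deriv_artanh_same perm3_distinct[OF p]
  by (simp add: antider_def rho_upd[OF p] rho_perm3[OF p] nonvanishing_perm3[OF p])

lemma antider_artanh_other:
  "antider nonvanishing i (\<lambda>d. artanh (d j / rho d))
     (\<lambda>d. - (d i * d j / (rho d * (d i ^ 2 + d k ^ 2))))"
  using deriv_artanh_other perm3_distinct[OF p]
  by (simp add: antider_def rho_upd[OF p] rho_perm3[OF p] nonvanishing_perm3[OF p])

lemma antider_arctan_other:
  "antider nonvanishing i (\<lambda>d. arctan (d i * d j / (d k * rho d)))
     (\<lambda>d. d k * d j / (rho d * (d i ^ 2 + d k ^ 2)))"
  using deriv_arctan_other perm3_distinct[OF p]
  by (simp add: antider_def rho_upd[OF p] rho_perm3[OF p] nonvanishing_perm3[OF p])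

lemma antider_arctan_same:
  "antider nonvanishing i (\<lambda>d. arctan (d j * d k / (d i * rho d)))
     (\<lambda>d. - (d j * d k / (rho d * (d i ^ 2 + d j ^ 2)) + d j * d k / (rho d * (d i ^ 2 + d k ^ 2))))"
  using deriv_arctan_same perm3_distinct[OF p]
  by (simp add: antider_def rho_upd[OF p] rho_perm3[OF p] nonvanishing_perm3[OF p])

lemma perm3_neqs: "i \<noteq> j" "i \<noteq> k" "j \<noteq> k" "j \<noteq> i" "k \<noteq> i" "k \<noteq> j"
  using perm3_distinct[OF p] by auto

text \<open>From $(x^{m+1}\rho)' = (m+2)\,x^{m+2}/\rho + (m+1)(y^2+z^2)\,x^m/\rho$. The factor $y^2+z^2$ keeps the
  \<open>artanh\<close> produced at $m = 0$ inside the module.\<close>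

lemma antiderivable_power_div_rho_aux:
  "antiderivable nonvanishing i Mgen (\<lambda>d. (d j ^ 2 + d k ^ 2) * (d i ^ m / rho d)) \<and>
   antiderivable nonvanishing i Mgen (\<lambda>d. d i ^ Suc m / rho d)"
proof (induction m)
  case 0
  have "(\<lambda>d. d j * (d j * artanh (d i / rho d)) + d k * (d k * artanh (d i / rho d))) \<in> qspan Mgen"
    using p by (intro qs_add qspan_mult[OF qspan_base] MgenI qp_var) (rule perm3_orders)+
  then have "(\<lambda>d. (d j ^ 2 + d k ^ 2) * artanh (d i / rho d)) \<in> qspan Mgen"
    by (simp add: algebra_simps power2_eq_square)
  moreover have "antider nonvanishing i (\<lambda>d. (d j ^ 2 + d k ^ 2) * artanh (d i / rho d))
      (\<lambda>d. (d j ^ 2 + d k ^ 2) * (1 / rho d))"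
    by (intro antider_mult indep_intros antider_artanh_same perm3_neqs)
  ultimately have "antiderivable nonvanishing i Mgen (\<lambda>d. (d j ^ 2 + d k ^ 2) * (1 / rho d))"
    by (rule antiderivable_direct)
  moreover have "antiderivable nonvanishing i Mgen (\<lambda>d. d i / rho d)"
    by (rule antiderivable_direct[OF qspan_base[OF MgenI(1)] antider_rho])
  ultimately show ?case by simp
next
  case (Suc m)
  have "antiderivable nonvanishing i Mgen (\<lambda>d. (d j ^ 2 + d k ^ 2) * (d i ^ Suc m / rho d))"
    by (intro antiderivable_mult qpoly_intros indep_intros perm3_neqs Suc.IH[THEN conjunct2])
  moreover have "antiderivable nonvanishing i Mgen (\<lambda>d. d i ^ Suc (Suc m) / rho d)"
  proof (rule antiderivable_by)
    define c :: real where "c = 1 / real (Suc (Suc m))"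
    have c: "c \<in> \<rat>" "- c * real (Suc m) \<in> \<rat>" by (auto simp: c_def)
    show "(\<lambda>d. c * (d i ^ Suc m * rho d)) \<in> qspan Mgen"
      by (intro qspan_mult[OF qspan_mult] qspan_base MgenI qpoly_intros c)
    show "antider nonvanishing i (\<lambda>d. c * (d i ^ Suc m * rho d))
       (\<lambda>d. c * ((real (Suc m) * d i ^ m) * rho d + d i ^ Suc m * (d i / rho d)))"
      by (intro antider_mult[OF indep_intros(1)] antider_prod[OF antider_power antider_rho])
    show "antiderivable nonvanishing i Mgen
       (\<lambda>d. (- c * real (Suc m)) * ((d j ^ 2 + d k ^ 2) * (d i ^ m / rho d)))"
      by (intro antiderivable_mult[OF qp_const[OF c(2)] indep_intros(1)] Suc.IH[THEN conjunct1])
    fix d assume d: "d \<in> nonvanishing"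
    have r: "rho d > 0" "rho d ^ 2 = d i ^ 2 + d j ^ 2 + d k ^ 2"
      using rho_pos[OF d] by (auto simp: rho_perm3[OF p])
    have "c * real (Suc (Suc m)) = 1" by (simp add: c_def)
    then have c1: "c * (1 + real (Suc m)) = 1" by simp
    \<comment> \<open>Here \<open>y\<close> is \<open>d i\<close>, \<open>x\<close> is
      \<open>d i ^ m\<close>, \<open>b\<close> is the sum of the other two squares and
      \<open>s\<close> is \<open>m + 1\<close>. Replacing \<open>r\<close> by
      \<open>(y^2 + b) / r\<close> cancels the \<open>b\<close> terms and leaves
      \<open>c * (1 + s)\<close> times the target.\<close>
    have "c * ((s * x) * r + (x * y) * (y / r)) + (- c * s) * (b * (x / r)) = y * (y * x) / r"
      if "c * (1 + s) = 1" "r^2 = y^2 + b" "r > 0" for b s x y r :: real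
    proof -
      have "r = (y * y + b) / r"
        using that by (simp add: field_simps power2_eq_square)
      then have r: "(s * x) * r = (s * x) * ((y * y + b) / r)" by simp
      have "c * ((s * x) * r + (x * y) * (y / r)) + (- c * s) * (b * (x / r))
          = (c * (1 + s)) * (y * (y * x) / r)"
        unfolding r by (simp add: field_simps add_divide_distrib)
      then show ?thesis using that by simp
    qed
    from this[OF c1 _ r(1), of "d i" "d j ^ 2 + d k ^ 2" "d i ^ m"] r(2)
    show "d i ^ Suc (Suc m) / rho d =
        c * ((real (Suc m) * d i ^ m) * rho d + d i ^ Suc m * (d i / rho d)) +
        (- c * real (Suc m)) * ((d j ^ 2 + d k ^ 2) * (d i ^ m / rho d))"
      by (simp add: add.assoc mult.commute mult.left_commute)
  qed
  ultimately show ?case by blast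
qed

lemmas antiderivable_squares_power_div_rho = antiderivable_power_div_rho_aux[THEN conjunct1]
lemmas antiderivable_power_div_rho = antiderivable_power_div_rho_aux[THEN conjunct2]

text \<open>At \<open>m = 0\<close> the factor \<open>d j\<close> is what makes
  \<open>d j * artanh (d i / rho d)\<close> a generator; from \<open>m = 1\<close> on the power of
  \<open>d i\<close> suffices by itself.\<close>

lemma antiderivable_other_power_div_rho:
  "antiderivable nonvanishing i Mgen (\<lambda>d. d j * (d i ^ m / rho d))"
proof (cases m)
  case 0
  have "antiderivable nonvanishing i Mgen (\<lambda>d. d j * (1 / rho d))"
    by (rule antiderivable_direct[OF qspan_base[OF MgenI(2)[OF perm3_orders(3)]]])
      (intro antider_mult indep_intros antider_artanh_same perm3_neqs)
  with 0 show ?thesis by simp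
next
  case (Suc n)
  show ?thesis
    unfolding Suc by (intro antiderivable_mult qpoly_intros indep_intros perm3_neqs antiderivable_power_div_rho)
qed

text \<open>The factors \<open>d k\<close> are spent at the bottom of the recursion: at
  \<open>m = 0\<close> one completes the arctan derivative and one makes the arctan a generator; at
  \<open>m = 1\<close> one goes to the artanh. The recursion lowers \<open>m\<close> by two, so both
  starting values occur.\<close>

lemma antiderivable_q_square:
  "antiderivable nonvanishing i Mgen (\<lambda>d. d k ^ 2 * (d i ^ m * d j / (rho d * (d i ^ 2 + d k ^ 2))))"
proof (induction m rule: induct_nat_012)
  case 0
  have "antiderivable nonvanishing i Mgen (\<lambda>d. d k * (d k * d j / (rho d * (d i ^ 2 + d k ^ 2))))"
    by (rule antiderivable_direct[OF qspan_base[OF MgenI(3)[OF perm3_orders(6)]]])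
      (intro antider_mult indep_intros antider_arctan_other perm3_neqs)
  then show ?case by (simp add: power2_eq_square mult.assoc)
next
  case 1
  have "antiderivable nonvanishing i Mgen (\<lambda>d. d k * - (d i * d j / (rho d * (d i ^ 2 + d k ^ 2))))"
    by (rule antiderivable_direct[OF qspan_base[OF MgenI(2)[OF perm3_orders(4)]]])
      (intro antider_mult indep_intros antider_artanh_other perm3_neqs)
  then have "antiderivable nonvanishing i Mgen
     (\<lambda>d. (- 1 * d k) * (d k * - (d i * d j / (rho d * (d i ^ 2 + d k ^ 2)))))"
    by (intro antiderivable_mult[where c = "\<lambda>d. - 1 * d k"] qpoly_intros indep_intros perm3_neqs)
      (assumption | simp)+
  then show ?case by (simp add: power2_eq_square mult.assoc)
next
  case (ge2 m)
  have "antiderivable nonvanishing i Mgen (\<lambda>d. d k ^ 2 * (d j * (d i ^ m / rho d)))"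
    by (intro antiderivable_mult[where c = "\<lambda>d. d k ^ 2"] qpoly_intros indep_intros perm3_neqs
      antiderivable_other_power_div_rho)
  moreover have "antiderivable nonvanishing i Mgen
     (\<lambda>d. (- 1 * d k ^ 2) * (d k ^ 2 * (d i ^ m * d j / (rho d * (d i ^ 2 + d k ^ 2)))))"
    using ge2.IH(1)
    by (intro antiderivable_mult[where c = "\<lambda>d. - 1 * d k ^ 2"] qpoly_intros indep_intros perm3_neqs)
      (assumption | simp)+
  ultimately have "antiderivable nonvanishing i Mgen (\<lambda>d. d k ^ 2 * (d j * (d i ^ m / rho d)) +
     (- 1 * d k ^ 2) * (d k ^ 2 * (d i ^ m * d j / (rho d * (d i ^ 2 + d k ^ 2)))))"
    by (rule antiderivable_add)
  then show ?case
  proof (rule antiderivable_cong)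
    fix d assume d: "d \<in> nonvanishing"
    then have "0 < d i ^ 2 + d k ^ 2" "0 < rho d"
      using rho_pos[OF d] nonvanishing_perm3[OF p] by (metis sum_power2_gt_zero_iff, blast)
    then have "d i ^ Suc (Suc m) * d j / (rho d * (d i ^ 2 + d k ^ 2)) =
        d j * (d i ^ m / rho d) + - 1 * (d k ^ 2 * (d i ^ m * d j / (rho d * (d i ^ 2 + d k ^ 2))))"
      by (intro power_div_sum_squares) auto
    then show "d k ^ 2 * (d i ^ Suc (Suc m) * d j / (rho d * (d i ^ 2 + d k ^ 2))) =
       d k ^ 2 * (d j * (d i ^ m / rho d)) +
       (- 1 * d k ^ 2) * (d k ^ 2 * (d i ^ m * d j / (rho d * (d i ^ 2 + d k ^ 2))))"
      by (simp only: distrib_left)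
  qed
qed

text \<open>One step of the recursion creates the factor \<open>d k ^ 2\<close> by itself, so from
  the second power on none has to be supplied in front.\<close>

lemma antiderivable_q:
  "antiderivable nonvanishing i Mgen (\<lambda>d. d i ^ Suc (Suc m) * d j / (rho d * (d i ^ 2 + d k ^ 2)))"
proof -
  have "antiderivable nonvanishing i Mgen (\<lambda>d. d j * (d i ^ m / rho d) +
     - 1 * (d k ^ 2 * (d i ^ m * d j / (rho d * (d i ^ 2 + d k ^ 2)))))"
    by (intro antiderivable_add antiderivable_mult[where c = "\<lambda>_. - 1"] qpoly_intros indep_intros perm3_neqs
      antiderivable_other_power_div_rho antiderivable_q_square) (assumption | simp)+
  then show ?thesis
  proof (rule antiderivable_cong)
    fix d assume d: "d \<in> nonvanishing"
    then have "0 < d i ^ 2 + d k ^ 2" "0 < rho d"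
      using rho_pos[OF d] nonvanishing_perm3[OF p] by (metis sum_power2_gt_zero_iff, blast)
    then show "d i ^ Suc (Suc m) * d j / (rho d * (d i ^ 2 + d k ^ 2)) =
       d j * (d i ^ m / rho d) + - 1 * (d k ^ 2 * (d i ^ m * d j / (rho d * (d i ^ 2 + d k ^ 2))))"
      by (intro power_div_sum_squares) auto
  qed
qed

text \<open>Integration by parts raises the power to \<open>m + 2\<close>, exactly what
  \<open>antiderivable_q\<close> asks for.\<close>

lemma antiderivable_artanh_other:
  "antiderivable nonvanishing i Mgen (\<lambda>d. d i ^ m * artanh (d j / rho d))"
proof (rule antiderivable_by_parts[OF antider_artanh_other])
  have "(\<lambda>d. d i ^ m * (d i * artanh (d j / rho d))) \<in> qspan Mgen"
    using p by (intro qspan_mult qspan_base MgenI qpoly_intros) (rule perm3_orders)+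
  then show "(\<lambda>d. d i ^ Suc m * artanh (d j / rho d)) \<in> qspan Mgen"
    by (simp add: ac_simps)
  have "antiderivable nonvanishing i Mgen (\<lambda>d. - 1 * (d i ^ Suc (Suc m) * d j / (rho d * (d i ^ 2 + d k ^ 2))))"
    by (intro antiderivable_mult[where c = "\<lambda>_. - 1"] qpoly_intros indep_intros antiderivable_q) simp
  then show "antiderivable nonvanishing i Mgen (\<lambda>d. d i ^ Suc m * - (d i * d j / (rho d * (d i ^ 2 + d k ^ 2))))"
    by (simp add: ac_simps)
qed

text \<open>\<open>rho = rho^2 / rho\<close>, with the squares of the other two coordinates kept
  together as the factor required at \<open>m = 0\<close>.\<close>

lemma antiderivable_rho: "antiderivable nonvanishing i Mgen (\<lambda>d. d i ^ m * rho d)"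
proof -
  have "antiderivable nonvanishing i Mgen
     (\<lambda>d. d i ^ Suc (Suc m) / rho d + (d j ^ 2 + d k ^ 2) * (d i ^ m / rho d))"
    by (intro antiderivable_add antiderivable_power_div_rho antiderivable_squares_power_div_rho)
  then show ?thesis
  proof (rule antiderivable_cong)
    fix d assume d: "d \<in> nonvanishing"
    have r: "rho d > 0" "rho d * rho d = d i ^ 2 + (d j ^ 2 + d k ^ 2)"
      using rho_pos[OF d] by (auto simp: rho_perm3[OF p] simp flip: power2_eq_square)
    have "d i ^ m * (rho d * rho d) = d i ^ Suc (Suc m) + (d j ^ 2 + d k ^ 2) * d i ^ m"
      unfolding r(2) by (simp add: algebra_simps power2_eq_square)
    then show "d i ^ m * rho d = d i ^ Suc (Suc m) / rho d + (d j ^ 2 + d k ^ 2) * (d i ^ m / rho d)"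
      using r(1) by (simp add: divide_simps)
  qed
qed

lemma antiderivable_artanh_same:
  "antiderivable nonvanishing i Mgen (\<lambda>d. d i ^ m * (d j * artanh (d i / rho d)))"
proof (rule antiderivable_by_parts)
  show "antider nonvanishing i (\<lambda>d. d j * artanh (d i / rho d)) (\<lambda>d. d j * (1 / rho d))"
    by (intro antider_mult antider_artanh_same indep_intros perm3_neqs)
  show "(\<lambda>d. d i ^ Suc m * (d j * artanh (d i / rho d))) \<in> qspan Mgen"
    using p by (intro qspan_mult qspan_base MgenI qpoly_intros) (rule perm3_orders)+
  have "antiderivable nonvanishing i Mgen (\<lambda>d. d j * (d i ^ Suc m / rho d))"
    by (rule antiderivable_other_power_div_rho)
  then show "antiderivable nonvanishing i Mgen (\<lambda>d. d i ^ Suc m * (d j * (1 / rho d)))"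
    by (simp add: ac_simps)
qed

text \<open>The factor of the generator and the one from the arctan derivative combine to the
  \<open>d k ^ 2\<close> of \<open>antiderivable_q_square\<close>.\<close>

lemma antiderivable_arctan_other:
  "antiderivable nonvanishing i Mgen (\<lambda>d. d i ^ m * (d k * arctan (d i * d j / (d k * rho d))))"
proof (rule antiderivable_by_parts)
  show "antider nonvanishing i (\<lambda>d. d k * arctan (d i * d j / (d k * rho d)))
      (\<lambda>d. d k * (d k * d j / (rho d * (d i ^ 2 + d k ^ 2))))"
    by (intro antider_mult antider_arctan_other indep_intros perm3_neqs)
  show "(\<lambda>d. d i ^ Suc m * (d k * arctan (d i * d j / (d k * rho d)))) \<in> qspan Mgen"
    using p by (intro qspan_mult qspan_base MgenI qpoly_intros) (rule perm3_orders)+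
  show "antiderivable nonvanishing i Mgen (\<lambda>d. d i ^ Suc m * (d k * (d k * d j / (rho d * (d i ^ 2 + d k ^ 2)))))"
    using antiderivable_q_square[of "Suc m"] by (simp add: ac_simps power2_eq_square)
qed

end

text \<open>The factor \<open>d i\<close> of the generator is read as one more power of the
  integration variable. After integration by parts both summands of the derivative contain
  \<open>d i ^ (m+2)\<close>, with \<open>j\<close> and \<open>k\<close> exchanging their
  roles.\<close>

lemma antiderivable_arctan_same:
  assumes p: "perm3 i j k"
  shows "antiderivable nonvanishing i Mgen (\<lambda>d. d i ^ m * (d i * arctan (d j * d k / (d i * rho d))))"
proof -
  have "antiderivable nonvanishing i Mgen (\<lambda>d. d i ^ Suc m * arctan (d j * d k / (d i * rho d)))"
  proof (rule antiderivable_by_parts[OF antider_arctan_same[OF p]])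
    have "(\<lambda>d. d i ^ Suc m * (d i * arctan (d j * d k / (d i * rho d)))) \<in> qspan Mgen"
      using p by (intro qspan_mult qspan_base MgenI qpoly_intros) (rule p)+
    then show "(\<lambda>d. d i ^ Suc (Suc m) * arctan (d j * d k / (d i * rho d))) \<in> qspan Mgen"
      by (simp add: ac_simps)
    have "antiderivable nonvanishing i Mgen (\<lambda>d.
        (- 1 * d j) * (d i ^ Suc (Suc m) * d k / (rho d * (d i ^ 2 + d j ^ 2))) +
        (- 1 * d k) * (d i ^ Suc (Suc m) * d j / (rho d * (d i ^ 2 + d k ^ 2))))"
      using p perm3_swap(1)[OF p] perm3_distinct[OF p]
      by (intro antiderivable_add antiderivable_mult qpoly_intros indep_intros antiderivable_q) auto
    then show "antiderivable nonvanishing i Mgen (\<lambda>d. d i ^ Suc (Suc m) *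
        - (d j * d k / (rho d * (d i ^ 2 + d j ^ 2)) + d j * d k / (rho d * (d i ^ 2 + d k ^ 2))))"
      by (rule antiderivable_cong) (simp add: algebra_simps)
  qed
  then show ?thesis by (simp add: ac_simps)
qed

lemma antiderivable_Mgen:
  assumes "i \<in> {1,2,3}" "g \<in> Mgen"
  shows "antiderivable nonvanishing i Mgen (\<lambda>d. d i ^ m * g d)"
proof -
  obtain j k where p: "perm3 i j k"
    using assms(1) that[of 2 3] that[of 1 3] that[of 1 2] by (auto simp: perm3_def)
  consider "g = rho"
    | a b c where "perm3 a b c" "g = (\<lambda>d. d a * artanh (d c / rho d))"
    | a b c where "perm3 a b c" "g = (\<lambda>d. d a * arctan (d b * d c / (d a * rho d)))"
    using assms(2) unfolding Mgen_def by blast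
  then show ?thesis
  proof cases
    case 1
    then show ?thesis using antiderivable_rho[OF p] by simp
  next
    case (2 a b c)
    have "i = a \<or> i = b \<or> i = c" using assms(1) 2(1) by (auto simp: perm3_def)
    then show ?thesis
    proof (elim disjE)
      assume i: "i = a"
      have "antiderivable nonvanishing a Mgen (\<lambda>d. d a ^ Suc m * artanh (d c / rho d))"
        using antiderivable_artanh_other[OF perm3_swap(1)[OF 2(1)]] .
      then show ?thesis by (simp add: 2(2) i ac_simps)
    next
      assume i: "i = b"
      have "antiderivable nonvanishing b Mgen (\<lambda>d. d a * (d b ^ m * artanh (d c / rho d)))"
        using perm3_distinct[OF 2(1)]
        by (intro antiderivable_mult qpoly_intros indep_intros
            antiderivable_artanh_other[OF perm3_swap(4)[OF 2(1)]]) auto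
      then show ?thesis by (simp add: 2(2) i ac_simps)
    next
      assume "i = c"
      then show ?thesis using antiderivable_artanh_same[OF perm3_swap(5)[OF 2(1)]] 2(2) by simp
    qed
  next
    case (3 a b c)
    have "i = a \<or> i = b \<or> i = c" using assms(1) 3(1) by (auto simp: perm3_def)
    then show ?thesis
    proof (elim disjE)
      assume "i = a"
      then show ?thesis using antiderivable_arctan_same[OF 3(1)] 3(2) by simp
    next
      assume "i = b"
      then show ?thesis using antiderivable_arctan_other[OF perm3_swap(4)[OF 3(1)]] 3(2) by simp
    next
      assume i: "i = c"
      show ?thesis using antiderivable_arctan_other[OF perm3_swap(3)[OF 3(1)]] 3(2) i
        by (simp add: mult.commute)
    qed
  qed
qed

section \<open>The three integrations that start from a kernel\<close>

text \<open>The antiderivative of a kernel in direction \<open>j\<close>, and its antiderivative in direction \<open>k\<close>, leave the module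
  only by the generators added here; the third integration returns to \<open>Mgen\<close>.\<close>

definition N1gen :: "nat \<Rightarrow> ((nat \<Rightarrow> real) \<Rightarrow> real) set" where
  "N1gen j = Mgen \<union> {\<lambda>d. 1 / rho d, \<lambda>d. artanh (d j / rho d)}"

definition N2gen :: "nat \<Rightarrow> ((nat \<Rightarrow> real) \<Rightarrow> real) set" where
  "N2gen k = Mgen \<union> {\<lambda>d. artanh (d k / rho d)}"

text \<open>Only \<open>m = 0\<close> leaves the module: \<open>1 / rho d\<close> without a factor
  integrates to \<open>artanh (d i / rho d)\<close> without a factor.\<close>

lemma antiderivable_inverse_rho:
  assumes "perm3 i j k"
  shows "antiderivable nonvanishing i (N2gen i) (\<lambda>d. d i ^ m * (1 / rho d))"
proof (cases m)
  case 0
  have "antiderivable nonvanishing i (N2gen i) (\<lambda>d. 1 / rho d)"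
    by (rule antiderivable_direct[OF qspan_base antider_artanh_same[OF assms]]) (simp add: N2gen_def)
  with 0 show ?thesis by simp
next
  case (Suc n)
  then show ?thesis
    using antiderivable_mono[OF antiderivable_power_div_rho[OF assms, of n], of "N2gen i"]
    by (auto simp: N2gen_def)
qed

text \<open>\<open>d i / rho d ^ 3\<close> is the derivative of \<open>- 1 / rho d\<close>;
  integration by parts reduces higher powers to the potential kernel.\<close>

lemma antiderivable_force_kernel:
  assumes p: "perm3 i j k"
  shows "antiderivable nonvanishing i (N1gen i) (\<lambda>d. d i ^ m * (d i / rho d ^ 3))"
proof -
  have A: "antider nonvanishing i (\<lambda>d. - 1 * (1 / rho d)) (\<lambda>d. d i / rho d ^ 3)"
    unfolding antider_def
  proof
    fix d assume d: "d \<in> nonvanishing"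
    have "((\<lambda>t. rho (d(i := t))) has_real_derivative d i / rho d) (at (d i))"
      using antider_rho[OF p] d by (auto simp: antider_def)
    then show "((\<lambda>t. - 1 * (1 / rho (d(i := t)))) has_real_derivative d i / rho d ^ 3) (at (d i))"
      using rho_pos[OF d] by (auto intro!: derivative_eq_intros simp: power3_eq_cube)
  qed
  have B: "(\<lambda>d. (- 1 * d i ^ m) * (1 / rho d)) \<in> qspan (N1gen i)" for m
    by (intro qspan_mult qspan_base qpoly_intros) (auto simp: N1gen_def)
  show ?thesis
  proof (cases m)
    case 0
    have "antiderivable nonvanishing i (N1gen i) (\<lambda>d. d i / rho d ^ 3)"
      using antiderivable_direct[OF _ A] B[of 0] by simp
    with 0 show ?thesis by simp
  next
    case (Suc n)
    have "antiderivable nonvanishing i (N1gen i) (\<lambda>d. d i ^ Suc n * (d i / rho d ^ 3))"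
    proof (rule antiderivable_by)
      show "(\<lambda>d. (- 1 * d i ^ Suc n) * (1 / rho d)) \<in> qspan (N1gen i)" by (rule B)
      have "antider nonvanishing i (\<lambda>d. d i ^ Suc n * (- 1 * (1 / rho d)))
        (\<lambda>d. (real (Suc n) * d i ^ n) * (- 1 * (1 / rho d)) + d i ^ Suc n * (d i / rho d ^ 3))"
        by (rule antider_prod[OF antider_power A])
      then show "antider nonvanishing i (\<lambda>d. (- 1 * d i ^ Suc n) * (1 / rho d))
        (\<lambda>d. (real (Suc n) * d i ^ n) * (- 1 * (1 / rho d)) + d i ^ Suc n * (d i / rho d ^ 3))"
        by (simp add: mult.assoc)
      show "antiderivable nonvanishing i (N1gen i) (\<lambda>d. real (Suc n) * (d i ^ n * (1 / rho d)))"
        by (intro antiderivable_mult qpoly_intros indep_intros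
            antiderivable_mono[OF antiderivable_inverse_rho[OF p]]) (auto simp: N1gen_def N2gen_def)
    qed (simp add: algebra_simps add_divide_distrib)
    with Suc show ?thesis by simp
  qed
qed

lemma antiderivable_potential_kernel:
  assumes "perm3 i j k"
  shows "antiderivable nonvanishing i (N1gen i) (\<lambda>d. d i ^ m * (1 / rho d))"
  by (rule antiderivable_mono[OF antiderivable_inverse_rho[OF assms]]) (auto simp: N1gen_def N2gen_def)

text \<open>The second direction differs from the first, so
  \<open>antiderivable_artanh_other\<close> takes \<open>artanh (d j / rho d)\<close> into the
  module. The extra artanh of \<open>N2gen\<close> stems from \<open>1 / rho d\<close>
  alone.\<close>

lemma antiderivable_N1gen:
  assumes p: "perm3 i j k" and g: "g \<in> N1gen j"
  shows "antiderivable nonvanishing i (N2gen i) (\<lambda>d. d i ^ m * g d)"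
proof -
  have i: "i \<in> {1,2,3}" using p by (auto simp: perm3_def)
  have M: "antiderivable nonvanishing i Mgen f \<Longrightarrow> antiderivable nonvanishing i (N2gen i) f" for f
    by (erule antiderivable_mono) (auto simp: N2gen_def)
  show ?thesis
    using g antiderivable_inverse_rho[OF p, of m] M[OF antiderivable_artanh_other[OF p, of m]]
      M[OF antiderivable_Mgen[OF i, of g m]]
    by (auto simp: N1gen_def)
qed

lemma antiderivable_N2gen:
  assumes p: "perm3 i j k" and g: "g \<in> N2gen j"
  shows "antiderivable nonvanishing i Mgen (\<lambda>d. d i ^ m * g d)"
proof -
  have i: "i \<in> {1,2,3}" using p by (auto simp: perm3_def)
  show ?thesis
    using g antiderivable_artanh_other[OF p, of m] antiderivable_Mgen[OF i, of g m]
    by (auto simp: N2gen_def)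
qed

section \<open>Coefficients depending on both points\<close>

text \<open>A configuration assigns \<^term>\<open>x\<^sub>i\<close> to \<^term>\<open>(False, i)\<close> and \<^term>\<open>y\<^sub>i\<close> to \<^term>\<open>(True, i)\<close>.\<close>

definition dl :: "(bool \<times> nat \<Rightarrow> real) \<Rightarrow> nat \<Rightarrow> real" where
  "dl v i = v (False, i) - v (True, i)"

definition pull :: "((nat \<Rightarrow> real) \<Rightarrow> real) set \<Rightarrow> ((bool \<times> nat \<Rightarrow> real) \<Rightarrow> real) set" where
  "pull B = (\<lambda>g v. g (dl v)) ` B"

definition separated :: "(bool \<times> nat \<Rightarrow> real) set" where
  "separated = {v. dl v \<in> nonvanishing}"

lemma qspan_pull: "H \<in> qspan B \<Longrightarrow> (\<lambda>v. H (dl v)) \<in> qspan (pull B)"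
proof (induction rule: qspan.induct)
  case (qs_gen c g)
  have "(\<lambda>v. c (dl v)) \<in> qpoly"
    by (rule qpoly_subst[OF qs_gen(1)]) (auto simp: dl_def intro: qpoly_intros)
  moreover have "(\<lambda>v. g (dl v)) \<in> pull B" using qs_gen by (auto simp: pull_def)
  ultimately show ?case by (rule qspan.qs_gen)
next
  case (qs_add f g)
  from qs_add.IH show ?case by (rule qspan.qs_add)
qed

text \<open>Stability of \<open>tspan\<close> under all polynomials encodes the expansion of a coefficient in powers of
  \<open>dl v j\<close>, the other coordinate of the pair being kept fixed.\<close>

inductive_set tspan :: "bool \<Rightarrow> nat \<Rightarrow> ((nat \<Rightarrow> real) \<Rightarrow> real) \<Rightarrow> ((bool \<times> nat \<Rightarrow> real) \<Rightarrow> real) set"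
  for s j g where
  ts_gen: "c \<in> qpoly \<Longrightarrow> indep c (s, j) \<Longrightarrow> (\<lambda>v. c v * (dl v j ^ m * g (dl v))) \<in> tspan s j g"
| ts_add: "f \<in> tspan s j g \<Longrightarrow> f' \<in> tspan s j g \<Longrightarrow> (\<lambda>v. f v + f' v) \<in> tspan s j g"

lemma tspan_indep_mult:
  assumes "f \<in> tspan s j g" "c \<in> qpoly" "indep c (s, j)"
  shows "(\<lambda>v. c v * f v) \<in> tspan s j g"
  using assms(1)
proof induction
  case (ts_gen c' m)
  have "(\<lambda>v. (c v * c' v) * (dl v j ^ m * g (dl v))) \<in> tspan s j g"
    using assms(2,3) ts_gen by (intro tspan.ts_gen qp_mult indep_intros)
  then show ?case by (simp only: mult.assoc)
next
  case (ts_add f f')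
  from tspan.ts_add[OF ts_add.IH] show ?case by (simp only: distrib_left)
qed

lemma tspan_dl_mult:
  assumes "f \<in> tspan s j g"
  shows "(\<lambda>v. dl v j * f v) \<in> tspan s j g"
  using assms
proof induction
  case (ts_gen c m)
  from tspan.ts_gen[OF ts_gen, of "Suc m"] show ?case
    by (simp only: power_Suc mult.assoc mult.left_commute)
next
  case (ts_add f f')
  from tspan.ts_add[OF ts_add.IH] show ?case by (simp only: distrib_left)
qed

lemma tspan_mult:
  assumes "p \<in> qpoly" "f \<in> tspan s j g"
  shows "(\<lambda>v. p v * f v) \<in> tspan s j g"
  using assms
proof (induction arbitrary: f)
  case (qp_const c)
  then show ?case by (intro tspan_indep_mult[where c = "\<lambda>_. c"] qpoly_intros indep_intros)
next
  case (qp_var i)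
  show ?case
  proof (cases "i = (s, j)")
    case True
    \<comment> \<open>\<open>x j = y j + d j\<close> and \<open>y j = x j - d j\<close>: the sign
      depends on which point is moved.\<close>
    define e :: real where "e = (if s then - 1 else 1)"
    have e: "e \<in> \<rat>" by (simp add: e_def)
    have "(\<lambda>v. v (\<not> s, j) * f v + e * (dl v j * f v)) \<in> tspan s j g"
      using qp_var
      by (intro ts_add tspan_indep_mult[where c = "\<lambda>v. v (\<not> s, j)"] tspan_indep_mult[where c = "\<lambda>_. e"]
          tspan_dl_mult qpoly_intros indep_intros e) auto
    moreover have "v (\<not> s, j) * f v + e * (dl v j * f v) = v i * f v" for v
      by (cases s) (simp_all add: True e_def dl_def algebra_simps)
    ultimately show ?thesis by simp
  next
    case False
    with qp_var show ?thesis
      by (intro tspan_indep_mult[where c = "\<lambda>v. v i"] qpoly_intros indep_intros)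
  qed
next
  case (qp_add p q)
  from ts_add[OF qp_add.IH[OF qp_add.prems]] show ?case by (simp only: distrib_right)
next
  case (qp_mult p q)
  from qp_mult.IH(1)[OF qp_mult.IH(2)[OF qp_mult.prems]] show ?case by (simp only: mult.assoc)
qed

lemma dl_upd: "dl (v((s, j) := t)) = (dl v)(j := (if s then v (False, j) - t else t - v (True, j)))"
  by (auto simp: dl_def)

text \<open>The sign is the inner derivative of \<open>d j = x j - y j\<close> when
  \<open>y j\<close> moves.\<close>

lemma antider_pull:
  assumes "antider nonvanishing j H h"
  shows "antider separated (s, j) (\<lambda>v. (if s then - 1 else 1) * H (dl v)) (\<lambda>v. h (dl v))"
  unfolding antider_def
proof
  fix v assume "v \<in> separated"
  then have H: "((\<lambda>t. H ((dl v)(j := t))) has_real_derivative h (dl v)) (at (dl v j))"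
    using assms by (auto simp: antider_def separated_def)
  show "((\<lambda>t. (if s then - 1 else 1) * H (dl (v((s, j) := t)))) has_real_derivative h (dl v)) (at (v (s, j)))"
  proof (cases s)
    case True
    have "((\<lambda>t. v (False, j) - t) has_real_derivative - 1) (at (v (True, j)))"
      by (auto intro!: derivative_eq_intros)
    from DERIV_cmult[OF DERIV_chain2[OF H[unfolded dl_def[of v j]] this], of "- 1"] True
    show ?thesis by (simp add: dl_upd)
  next
    case False
    have "((\<lambda>t. t - v (True, j)) has_real_derivative 1) (at (v (False, j)))"
      by (auto intro!: derivative_eq_intros)
    from DERIV_chain2[OF H[unfolded dl_def[of v j]] this] False
    show ?thesis by (simp add: dl_upd)
  qed
qed

text \<open>Expanding the coefficient in powers of \<open>d j\<close>, with coefficients independent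
  of the integration variable, reduces everything to integrands in the differences alone.\<close>

lemma antiderivable_pull:
  assumes B: "\<And>g m. g \<in> B \<Longrightarrow> antiderivable nonvanishing j B' (\<lambda>d. d j ^ m * g d)"
    and f: "f \<in> qspan (pull B)"
  shows "antiderivable separated (s, j) (pull B') f"
  using f
proof induction
  case (qs_gen c h)
  then obtain g where g: "g \<in> B" "h = (\<lambda>v. g (dl v))" by (auto simp: pull_def)
  have t: "antiderivable separated (s, j) (pull B') f" if "f \<in> tspan s j g" for f
    using that
  proof induction
    case (ts_gen c m)
    obtain H where H: "H \<in> qspan B'" "antider nonvanishing j H (\<lambda>d. d j ^ m * g d)"
      using B[OF g(1), of m] by (auto simp: antiderivable_def)
    have "(\<lambda>v. (if s then - 1 else 1) * H (dl v)) \<in> qspan (pull B')"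
      by (intro qspan_mult qspan_pull H(1) qp_const) auto
    from antiderivable_direct[OF this antider_pull[OF H(2)]]
    show ?case by (rule antiderivable_mult[OF ts_gen])
  next
    case (ts_add f f')
    from ts_add.IH show ?case by (rule antiderivable_add)
  qed
  have "(\<lambda>v. 1 * (dl v j ^ 0 * g (dl v))) \<in> tspan s j g"
    by (intro ts_gen qp_const indep_intros) simp
  then have "h \<in> tspan s j g" by (simp add: g)
  from t[OF tspan_mult[OF qs_gen(1) this]] show ?case .
next
  case (qs_add f g)
  from qs_add.IH show ?case by (rule antiderivable_add)
qed

section \<open>Continuity of the basic terms\<close>

lemma continuous_on_coord [continuous_intros]: "continuous_on A (\<lambda>v. v i :: real)"
  by (rule continuous_on_qpoly[OF qp_var])

lemma continuous_on_rho [continuous_intros]: "continuous_on A rho"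
  unfolding rho_def by (intro continuous_intros)

lemma continuous_on_artanh_compose:
  fixes f :: "'a::topological_space \<Rightarrow> real"
  assumes "continuous_on A f" "\<And>x. x \<in> A \<Longrightarrow> f x \<in> {-1<..<1}"
  shows "continuous_on A (\<lambda>x. artanh (f x))"
  by (rule continuous_on_compose2[OF continuous_on_artanh assms(1) order.refl])
    (use assms(2) in auto)

text \<open>Off the hyperplane continuity is a local matter. On it the product is 0 whatever value
  \<open>h\<close> takes there, and \<open>K\<close> squeezes the neighbouring values.\<close>

lemma continuous_on_mult_bounded:
  fixes h :: "('v::countable \<Rightarrow> real) \<Rightarrow> real"
  assumes h: "continuous_on {d. d i \<noteq> 0} h"
    and K: "continuous_on UNIV K" "\<And>d. d i = 0 \<Longrightarrow> K d = 0"
    and le: "\<And>d. \<bar>d i * h d\<bar> \<le> K d"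
  shows "continuous_on UNIV (\<lambda>d. d i * h d)"
proof (rule continuous_at_imp_continuous_on, rule ballI)
  fix e :: "'v \<Rightarrow> real"
  show "isCont (\<lambda>d. d i * h d) e"
  proof (cases "e i = 0")
    case True
    have "(K \<longlongrightarrow> K e) (at e)"
      using K(1) by (auto simp: continuous_on_def)
    moreover have "K e = 0" by (rule K(2)) (rule True)
    ultimately have "(K \<longlongrightarrow> 0) (at e)" by (simp only:)
    moreover have "eventually (\<lambda>d. norm (d i * h d) \<le> K d) (at e)"
      by (rule always_eventually) (simp only: real_norm_def le simp_thms)
    ultimately have "((\<lambda>d. d i * h d) \<longlongrightarrow> 0) (at e)"
      by (rule Lim_null_comparison[rotated])
    then show ?thesis using True by (simp add: isCont_def)
  next
    case False
    have "open {d :: 'v \<Rightarrow> real. d i \<noteq> 0}"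
      by (intro open_Collect_neq continuous_intros)
    moreover have "continuous_on {d. d i \<noteq> 0} (\<lambda>d. d i * h d)"
      using h by (intro continuous_intros)
    ultimately show ?thesis
      using False by (auto simp: continuous_on_eq_continuous_at)
  qed
qed

text \<open>From \<open>artanh t = ln ((1 + t) / (1 - t)) / 2\<close> and
  \<open>(1 + t) / (1 - t) = (1 + t)^2 / (1 - t^2) \<le> (2 / e)^2\<close>. It serves with
  \<open>e = |d i| / rho d\<close>.\<close>

lemma abs_artanh_le:
  fixes t e :: real
  assumes "\<bar>t\<bar> < 1" "0 < e" "e^2 \<le> 1 - t^2"
  shows "\<bar>artanh t\<bar> \<le> 2 * sqrt (2 / e)"
proof -
  have *: "artanh u \<le> 2 * sqrt (2 / e)" if u: "\<bar>u\<bar> < 1" "e^2 \<le> 1 - u^2" for u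
  proof -
    have "0 < 1 - u" "0 < 1 + u" using u by auto
    moreover have "1 - u^2 = (1 - u) * (1 + u)" by (simp add: power2_eq_square algebra_simps)
    ultimately have "(1 + u) / (1 - u) = (1 + u)^2 / (1 - u^2)"
      by (simp add: power2_eq_square)
    also have "\<dots> \<le> 2^2 / e^2"
      using u assms(2) by (intro frac_le power_mono) auto
    finally have "(1 + u) / (1 - u) \<le> (2 / e)^2" by (simp add: power_divide)
    then have "ln ((1 + u) / (1 - u)) \<le> ln ((2 / e)^2)"
      using \<open>0 < 1 - u\<close> \<open>0 < 1 + u\<close> assms(2) by (subst ln_le_cancel_iff) auto
    then have "artanh u \<le> ln (2 / e)"
      using assms(2) by (simp add: artanh_def ln_realpow)
    \<comment> \<open>The square root is extracted before \<open>ln s \<le> s\<close> is applied: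
      the bound \<open>2 / e\<close> itself, multiplied by \<open>|d i|\<close>, would leave
      \<open>2 * rho d\<close>, which need not vanish with \<open>d i\<close>.\<close>
    also have "\<dots> = 2 * ln (sqrt (2 / e))"
      using assms(2) by (subst ln_sqrt) auto
    also have "\<dots> \<le> 2 * sqrt (2 / e)"
      using ln_bound[of "sqrt (2 / e)"] assms(2) by simp
    finally show ?thesis .
  qed
  show ?thesis
    using *[of t] *[of "- t"] assms by (simp add: artanh_minus_real abs_le_iff)
qed

lemma rho_nonneg: "0 \<le> rho d"
  by (simp add: rho_def)

lemma rho_pos_perm3: "perm3 i j k \<Longrightarrow> d i \<noteq> 0 \<Longrightarrow> 0 < rho d"
  using sqrt_sum_squares_pos[of "d i" "d j" "d k"] by (simp add: rho_perm3[of i j k])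

lemma abs_div_rho_less_1:
  assumes "perm3 i j k" "d j \<noteq> 0 \<or> d k \<noteq> 0"
  shows "\<bar>d i / rho d\<bar> < 1"
  using abs_div_sqrt_less_1[OF assms(2)] by (simp add: rho_perm3[OF assms(1)])

lemma continuous_on_Mgen:
  assumes "g \<in> Mgen"
  shows "continuous_on A g"
proof (rule continuous_on_subset)
  consider "g = rho"
    | i j k where "perm3 i j k" "g = (\<lambda>d. d i * artanh (d k / rho d))"
    | i j k where "perm3 i j k" "g = (\<lambda>d. d i * arctan (d j * d k / (d i * rho d)))"
    using assms unfolding Mgen_def by blast
  then show "continuous_on UNIV g"
  proof cases
    case 1
    then show ?thesis by (simp add: continuous_on_rho)
  next
    case (2 i j k)
    have p: "perm3 k i j" "perm3 k j i" "perm3 i j k" using 2(1) perm3_swap[OF 2(1)] by auto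
    have "continuous_on UNIV (\<lambda>d. d i * artanh (d k / rho d))"
    \<comment> \<open>\<open>K d\<close> is \<open>|d i|\<close> times the bound of
      \<open>abs_artanh_le\<close> at \<open>e = |d i| / rho d\<close>.\<close>
    proof (rule continuous_on_mult_bounded[where K = "\<lambda>d. 2 * sqrt (2 * rho d * \<bar>d i\<bar>)"])
      show "continuous_on {d. d i \<noteq> 0} (\<lambda>d. artanh (d k / rho d))"
      proof -
        have "rho d \<noteq> 0" "d k / rho d \<in> {-1<..<1}" if "d i \<noteq> 0" for d
        proof -
          show "rho d \<noteq> 0" using rho_pos_perm3[OF p(3), of d, OF that] by simp
          have "\<bar>d k / rho d\<bar> < 1" using abs_div_rho_less_1[OF p(1), of d] that by blast
          then show "d k / rho d \<in> {-1<..<1}" unfolding greaterThanLessThan_iff by linarith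
        qed
        then show ?thesis by (intro continuous_on_artanh_compose continuous_intros) auto
      qed
      show "continuous_on UNIV (\<lambda>d. 2 * sqrt (2 * rho d * \<bar>d i\<bar>))"
        by (intro continuous_intros)
      fix d :: "nat \<Rightarrow> real"
      show "\<bar>d i * artanh (d k / rho d)\<bar> \<le> 2 * sqrt (2 * rho d * \<bar>d i\<bar>)"
      proof (cases "d i = 0")
        case False
        have r: "0 < rho d" "rho d ^ 2 = d i ^ 2 + d j ^ 2 + d k ^ 2"
          using rho_pos_perm3[OF p(3), of d, OF False] rho_perm3[OF p(3), of d] by auto
        have "\<bar>artanh (d k / rho d)\<bar> \<le> 2 * sqrt (2 / (\<bar>d i\<bar> / rho d))"
        proof (rule abs_artanh_le)
          show "\<bar>d k / rho d\<bar> < 1" using abs_div_rho_less_1[OF p(1), of d] False by simp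
          show "0 < \<bar>d i\<bar> / rho d" using r False by simp
          have "(\<bar>d i\<bar> / rho d)^2 + (d k / rho d)^2 = (d i ^ 2 + d k ^ 2) / rho d ^ 2"
            by (simp add: power_divide add_divide_distrib)
          also have "\<dots> \<le> 1"
          proof (rule divide_le_eq_1_pos[THEN iffD2])
            show "0 < rho d ^ 2" using r(1) by simp
            show "d i ^ 2 + d k ^ 2 \<le> rho d ^ 2" unfolding r(2) by simp
          qed
          finally show "(\<bar>d i\<bar> / rho d)^2 \<le> 1 - (d k / rho d)^2" by simp
        qed
        then have "\<bar>d i * artanh (d k / rho d)\<bar> \<le> \<bar>d i\<bar> * (2 * sqrt (2 / (\<bar>d i\<bar> / rho d)))"
          by (simp add: abs_mult mult_left_mono)
        also have "\<dots> = 2 * (sqrt (\<bar>d i\<bar>^2) * sqrt (2 / (\<bar>d i\<bar> / rho d)))" by simp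
        also have "\<dots> = 2 * sqrt (2 * rho d * \<bar>d i\<bar>)"
          unfolding real_sqrt_mult[symmetric] using False by (simp add: power2_eq_square field_simps)
        finally show ?thesis .
      qed simp
    qed simp
    then show ?thesis by (simp add: 2(2))
  next
    case (3 i j k)
    have "continuous_on UNIV (\<lambda>d. d i * arctan (d j * d k / (d i * rho d)))"
    proof (rule continuous_on_mult_bounded[where K = "\<lambda>d. \<bar>d i\<bar> * 2"])
      show "continuous_on {d. d i \<noteq> 0} (\<lambda>d. arctan (d j * d k / (d i * rho d)))"
      proof -
        have "d i * rho d \<noteq> 0" if "d i \<noteq> 0" for d
          using rho_pos_perm3[OF 3(1), of d, OF that] that by simp
        then show ?thesis by (intro continuous_intros) blast
      qed
      show "\<bar>d i * arctan (d j * d k / (d i * rho d))\<bar> \<le> \<bar>d i\<bar> * 2" for d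
      proof -
        have "\<bar>arctan (d j * d k / (d i * rho d))\<bar> \<le> 2"
          using arctan_bounded[of "d j * d k / (d i * rho d)"] pi_less_4 by (simp add: abs_le_iff)
        then show ?thesis by (simp add: abs_mult mult_left_mono)
      qed
    qed (intro continuous_intros | simp)+
    then show ?thesis by (simp add: 3(2))
  qed
qed simp

section \<open>The extra generators away from the coordinate axes\<close>

text \<open>Equivalently, at least two coordinates are nonzero.\<close>

definition two_nonzero :: "(nat \<Rightarrow> real) set" where
  "two_nonzero = {d. \<forall>i j k. perm3 i j k \<longrightarrow> d j \<noteq> 0 \<or> d k \<noteq> 0}"

lemma two_nonzeroI: "perm3 i j k \<Longrightarrow> d j \<noteq> 0 \<Longrightarrow> d k \<noteq> 0 \<Longrightarrow> d \<in> two_nonzero"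
proof -
  assume p: "perm3 i j k" and d: "d j \<noteq> 0" "d k \<noteq> 0"
  have "d b \<noteq> 0 \<or> d c \<noteq> 0" if q: "perm3 a b c" for a b c
  proof -
    have "b \<in> {i, j, k}" "c \<in> {i, j, k}" using p q unfolding perm3_def by blast+
    with perm3_distinct[OF q] d show ?thesis by auto
  qed
  then show ?thesis unfolding two_nonzero_def by blast
qed

lemma two_nonzeroD:
  assumes "perm3 i j k" "d \<in> two_nonzero"
  shows "d j \<noteq> 0 \<or> d k \<noteq> 0" "rho d \<noteq> 0"
proof -
  show "d j \<noteq> 0 \<or> d k \<noteq> 0" using assms unfolding two_nonzero_def by blast
  then show "rho d \<noteq> 0"
    using rho_pos_perm3[OF perm3_swap(2)[OF assms(1)], of d]
      rho_pos_perm3[OF perm3_swap(3)[OF assms(1)], of d] by force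
qed

lemma continuous_on_artanh_rho:
  assumes "perm3 i j k"
  shows "continuous_on two_nonzero (\<lambda>d. artanh (d i / rho d))"
proof -
  have "rho d \<noteq> 0" "d i / rho d \<in> {-1<..<1}" if "d \<in> two_nonzero" for d
  proof -
    show "rho d \<noteq> 0" using two_nonzeroD(2)[OF assms that] .
    have "\<bar>d i / rho d\<bar> < 1" using abs_div_rho_less_1[OF assms two_nonzeroD(1)[OF assms that]] .
    then show "d i / rho d \<in> {-1<..<1}" unfolding greaterThanLessThan_iff by linarith
  qed
  then show ?thesis by (intro continuous_on_artanh_compose continuous_intros) auto
qed

lemma continuous_on_N1gen:
  assumes "perm3 i j k" "g \<in> N1gen i"
  shows "continuous_on two_nonzero g"
proof -
  have "rho d \<noteq> 0" if "d \<in> two_nonzero" for d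
    using two_nonzeroD(2)[OF assms(1) that] .
  then have "continuous_on two_nonzero (\<lambda>d. 1 / rho d)"
    by (intro continuous_intros) auto
  with assms show ?thesis
    using continuous_on_artanh_rho continuous_on_Mgen by (auto simp: N1gen_def)
qed

lemma continuous_on_N2gen:
  assumes "perm3 i j k" "g \<in> N2gen i"
  shows "continuous_on two_nonzero g"
  using assms continuous_on_artanh_rho continuous_on_Mgen by (auto simp: N2gen_def)

lemma continuous_on_dl: "continuous_on A dl"
  unfolding dl_def by (intro continuous_intros)

lemma continuous_on_qspan_pull:
  assumes "f \<in> qspan (pull B)" "\<And>g. g \<in> B \<Longrightarrow> continuous_on S g" "\<And>v. v \<in> A \<Longrightarrow> dl v \<in> S"
  shows "continuous_on A f"
proof (rule continuous_on_qspan[OF assms(1)])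
  fix h assume "h \<in> pull B"
  then obtain g where "g \<in> B" "h = (\<lambda>v. g (dl v))" by (auto simp: pull_def)
  with assms(2,3) show "continuous_on A h"
    by (auto intro: continuous_on_compose2[OF _ continuous_on_dl])
qed

lemma continuous_on_pull_Mgen: "f \<in> qspan (pull Mgen) \<Longrightarrow> continuous_on A f"
  by (erule continuous_on_qspan_pull[where S = UNIV]) (auto intro: continuous_on_Mgen)

lemma continuous_on_upd [continuous_intros]:
  fixes f :: "'a::topological_space \<Rightarrow> 'v \<Rightarrow> real"
  assumes "continuous_on A f" "continuous_on A t"
  shows "continuous_on A (\<lambda>x. (f x)(w := t x))"
proof (rule continuous_on_coordinatewise_then_product)
  show "continuous_on A (\<lambda>x. ((f x)(w := t x)) i)" for i
    using assms(2) continuous_on_product_then_coordinatewise[OF assms(1), of i]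
    by (cases "i = w") simp_all
qed

section \<open>Integration along coordinate lines\<close>

lemma has_integral_line:
  fixes v :: "bool \<times> nat \<Rightarrow> real"
  assumes p: "perm3 j k l" and nz: "dl v k \<noteq> 0" "dl v l \<noteq> 0"
    and F: "antider separated (s, j) F f" "continuous_on {v. dl v \<in> two_nonzero} F" and ab: "a \<le> b"
  shows "((\<lambda>t. f (v((s, j) := t))) has_integral F (v((s, j) := b)) - F (v((s, j) := a))) {a..b}"
proof (rule fundamental_theorem_of_calculus_interior_strong)
  have kl: "dl (v((s, j) := t)) k = dl v k" "dl (v((s, j) := t)) l = dl v l" for t
    using perm3_distinct[OF p] by (simp_all add: dl_upd)
  show "((\<lambda>t. F (v((s, j) := t))) has_vector_derivative f (v((s, j) := t))) (at t)"
    if "t \<in> {a<..<b} - {v (\<not> s, j)}" for t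
  proof -
    have "dl (v((s, j) := t)) j \<noteq> 0"
      using that by (cases s) (auto simp: dl_upd)
    then have "v((s, j) := t) \<in> separated"
      using nz kl by (simp add: separated_def nonvanishing_perm3[OF p])
    then have "((\<lambda>u. F ((v((s, j) := t))((s, j) := u))) has_real_derivative f (v((s, j) := t)))
        (at ((v((s, j) := t)) (s, j)))"
      using F(1) unfolding antider_def by blast
    then show ?thesis by (simp add: has_real_derivative_iff_has_vector_derivative)
  qed
  have "v((s, j) := t) \<in> {v. dl v \<in> two_nonzero}" for t
    using two_nonzeroI[OF p, of "dl (v((s, j) := t))"] nz kl by simp
  then show "continuous_on {a..b} (\<lambda>t. F (v((s, j) := t)))"
    by (intro continuous_on_compose2[OF F(2)] continuous_intros) auto
qed (use ab in auto)

text \<open>The derivative is only known where no difference vanishes. On a degenerate line the formula follows by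
  shifting the two other coordinates by \<open>e\<close> and letting \<open>e\<close> tend to 0.\<close>

lemma integral_line:
  fixes v :: "bool \<times> nat \<Rightarrow> real"
  assumes j: "perm3 j k l"
    and F: "antider separated (s, j) F f" "continuous_on UNIV F" "continuous_on UNIV f" and ab: "a \<le> b"
  shows "integral {a..b} (\<lambda>t. f (v((s, j) := t))) = F (v((s, j) := b)) - F (v((s, j) := a))"
proof -
  define sh where "sh e = v((False, k) := v (False, k) + e, (False, l) := v (False, l) + e)" for e
  define G where "G e = F ((sh e)((s, j) := b)) - F ((sh e)((s, j) := a))
     - integral {a..b} (\<lambda>t. f ((sh e)((s, j) := t)))" for e
  \<comment> \<open>Joint continuity in \<open>e\<close> and \<open>t\<close> makes the error
    \<open>G\<close> continuous; this is where \<open>f\<close> must be continuous everywhere, as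
    members of the module are.\<close>
  have "continuous_on (UNIV \<times> cbox a b) (\<lambda>(e, t). f ((sh e)((s, j) := t)))"
    unfolding sh_def case_prod_unfold
    by (intro continuous_on_compose2[OF F(3)] continuous_intros) auto
  then have "continuous_on UNIV G"
    unfolding G_def sh_def
    by (intro continuous_intros continuous_on_compose2[OF F(2)]
        integral_continuous_on_param[of _ a b, unfolded cbox_interval]) (auto simp: sh_def)
  then have "(G \<longlongrightarrow> G 0) (at 0)"
    by (auto simp: continuous_on_def)
  moreover have "(G \<longlongrightarrow> 0) (at 0)"
  proof (rule tendsto_eventually)
    have "eventually (\<lambda>e. e \<noteq> - dl v k \<and> e \<noteq> - dl v l) (at 0)"
      by (intro eventually_conj eventually_neq_at_within)
    then show "eventually (\<lambda>e. G e = 0) (at 0)"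
    proof eventually_elim
      case (elim e)
      have "dl (sh e) k \<noteq> 0" "dl (sh e) l \<noteq> 0"
        using elim perm3_distinct[OF j] by (auto simp: sh_def dl_def)
      from has_integral_line[OF j this F(1) continuous_on_subset[OF F(2)] ab]
      show ?case by (simp add: G_def integral_unique)
    qed
  qed
  ultimately have "G 0 = 0"
    using tendsto_unique[OF trivial_limit_at] by blast
  moreover have "sh 0 = v" by (auto simp: sh_def)
  ultimately show ?thesis by (simp add: G_def)
qed

section \<open>Iterated integration\<close>

text \<open>Connects the two integrals: Fubini's theorem supplies Lebesgue integrability of a
  \<open>u\<close> known only almost everywhere, the fundamental theorem the value of a gauge
  integral.\<close>

lemma lborel_integral_AE_eq:
  fixes e u :: "real \<Rightarrow> real"
  assumes "integrable lborel u" "AE t in lborel. u t = indicator {a..b} t * e t"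
    "(e has_integral I) {a..b}"
  shows "integral\<^sup>L lborel u = I"
proof -
  have "(\<lambda>t. indicator {a..b} t * e t) = (\<lambda>t. if t \<in> {a..b} then e t else 0)"
    by (auto simp: indicator_def)
  then have "((\<lambda>t. indicator {a..b} t * e t) has_integral I) UNIV"
    using assms(3) by (simp only: has_integral_restrict_UNIV)
  moreover have "(u has_integral I) UNIV \<longleftrightarrow> ((\<lambda>t. indicator {a..b} t * e t) has_integral I) UNIV"
    by (rule has_integral_AE) (use assms(2) in simp)
  ultimately show ?thesis
    using has_integral_integral_lborel[OF assms(1)] has_integral_unique by blast
qed

section \<open>Fubini's theorem in different orders of integration\<close>

lemma fubini_2_fst:
  fixes g :: "real \<Rightarrow> real \<Rightarrow> real"
  assumes "integrable lborel (\<lambda>(b, c). g b c)"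
  shows "integrable lborel (\<lambda>b. LINT c|lborel. g b c)"
    "(LINT (b, c)|lborel. g b c) = (LINT b|lborel. LINT c|lborel. g b c)"
  using lborel_pair.integrable_fst[of g] lborel_pair.integral_fst[of g] assms by (simp_all add: lborel_prod)

lemma fubini_2_snd:
  fixes g :: "real \<Rightarrow> real \<Rightarrow> real"
  assumes "integrable lborel (\<lambda>(b, c). g b c)"
  shows "integrable lborel (\<lambda>c. LINT b|lborel. g b c)"
    "(LINT (b, c)|lborel. g b c) = (LINT c|lborel. LINT b|lborel. g b c)"
  using lborel_pair.integrable_snd[of g] lborel_pair.integral_snd[of g] assms by (simp_all add: lborel_prod)

text \<open>The first argument of \<open>h\<close> is integrated innermost. The outer integrand is
  replaced by a \<open>U\<close> that equals it almost everywhere, since the double inner integral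
  is controlled only for almost every \<open>c\<close>.\<close>

definition iterated_integral :: "(real \<Rightarrow> real \<Rightarrow> real \<Rightarrow> real) \<Rightarrow> real \<Rightarrow> bool" where
  "iterated_integral h I \<longleftrightarrow> (\<exists>U. integrable lborel U \<and> I = integral\<^sup>L lborel U \<and>
     (AE c in lborel. integrable lborel (\<lambda>b. LINT a|lborel. h a b c) \<and>
        U c = (LINT b|lborel. LINT a|lborel. h a b c)))"

context
  fixes g :: "real \<Rightarrow> real \<Rightarrow> real \<Rightarrow> real"
  assumes g: "integrable lborel (\<lambda>(a, b, c). g a b c)"
begin

lemma integrable_triple: "integrable (lborel \<Otimes>\<^sub>M lborel) (\<lambda>(a, z). case z of (b, c) \<Rightarrow> g a b c)"
  using g by (simp add: lborel_prod)

text \<open>The digits list the coordinates from the innermost to the outermost integration. There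
  is one order for each innermost direction, which a force component prescribes.\<close>

lemma fubini_321: "iterated_integral (\<lambda>c b a. g a b c) (LINT (a, b, c)|lborel. g a b c)"
proof -
  let ?h = "\<lambda>a z. case z of (b, c) \<Rightarrow> g a b c"
  have "AE a in lborel. integrable lborel (\<lambda>(b, c). g a b c)"
    using lborel_pair.AE_integrable_fst[of ?h, OF integrable_triple] .
  then have "AE a in lborel. integrable lborel (\<lambda>b. LINT c|lborel. g a b c) \<and>
      (LINT (b, c)|lborel. g a b c) = (LINT b|lborel. LINT c|lborel. g a b c)"
    by eventually_elim (intro conjI fubini_2_fst)
  moreover have "integrable lborel (\<lambda>a. LINT (b, c)|lborel. g a b c)"
    using lborel_pair.integrable_fst[of ?h, OF integrable_triple] .
  moreover have "(LINT (a, b, c)|lborel. g a b c) = (LINT a|lborel. LINT (b, c)|lborel. g a b c)"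
    using lborel_pair.integral_fst[of ?h, OF integrable_triple] by (simp add: lborel_prod)
  ultimately show ?thesis
    unfolding iterated_integral_def by blast
qed

lemma fubini_231: "iterated_integral (\<lambda>b c a. g a b c) (LINT (a, b, c)|lborel. g a b c)"
proof -
  let ?h = "\<lambda>a z. case z of (b, c) \<Rightarrow> g a b c"
  have "AE a in lborel. integrable lborel (\<lambda>(b, c). g a b c)"
    using lborel_pair.AE_integrable_fst[of ?h, OF integrable_triple] .
  then have "AE a in lborel. integrable lborel (\<lambda>c. LINT b|lborel. g a b c) \<and>
      (LINT (b, c)|lborel. g a b c) = (LINT c|lborel. LINT b|lborel. g a b c)"
    by eventually_elim (intro conjI fubini_2_snd)
  moreover have "integrable lborel (\<lambda>a. LINT (b, c)|lborel. g a b c)"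
    using lborel_pair.integrable_fst[of ?h, OF integrable_triple] .
  moreover have "(LINT (a, b, c)|lborel. g a b c) = (LINT a|lborel. LINT (b, c)|lborel. g a b c)"
    using lborel_pair.integral_fst[of ?h, OF integrable_triple] by (simp add: lborel_prod)
  ultimately show ?thesis
    unfolding iterated_integral_def by blast
qed

lemma fubini_132: "iterated_integral (\<lambda>a c b. g a b c) (LINT (a, b, c)|lborel. g a b c)"
proof -
  let ?h = "\<lambda>a z. case z of (b, c) \<Rightarrow> g a b c"
  let ?w = "\<lambda>b c. LINT a|lborel. g a b c"
  have w: "integrable lborel (\<lambda>(b, c). ?w b c)"
    using lborel_pair.integrable_snd[of ?h, OF integrable_triple] by (simp add: case_prod_unfold)
  have "AE b in lborel. integrable lborel (\<lambda>c. ?w b c)"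
    using lborel_pair.AE_integrable_fst[of ?w] w by (simp add: lborel_prod)
  moreover have "(LINT (a, b, c)|lborel. g a b c) = (LINT b|lborel. LINT c|lborel. ?w b c)"
    using lborel_pair.integral_snd[of ?h, OF integrable_triple] fubini_2_fst(2)[OF w]
    by (simp add: lborel_prod case_prod_unfold)
  ultimately show ?thesis
    using fubini_2_fst(1)[OF w] unfolding iterated_integral_def by auto
qed

end

text \<open>Each integration replaces a free coordinate by a bound. On every line the other two
  differences are then nonzero: for a coordinate already evaluated by \<open>nz\<close>, for one
  still free at almost every value.\<close>

lemma inner_integral:
  fixes v :: "bool \<times> nat \<Rightarrow> real" and a b :: "nat \<Rightarrow> real"
  assumes p: "perm3 j k l"
    and nz: "\<And>i. i \<in> {1,2,3} \<Longrightarrow> v (False, i) \<noteq> a i \<and> v (False, i) \<noteq> b i \<and> a i \<le> b i"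
    and F: "antider separated (True, j) F1 f" "antider separated (True, k) F2 F1"
      "antider separated (True, l) F3 F2"
    and cont: "\<And>F. F \<in> {f, F1, F2, F3} \<Longrightarrow> continuous_on {v. dl v \<in> two_nonzero} F"
  defines "\<phi> \<equiv> \<lambda>x y z. v((True, j) := x, (True, k) := y, (True, l) := z)"
  assumes I: "iterated_integral (\<lambda>x y z. indicator {a l..b l} z * (indicator {a k..b k} y *
     (indicator {a j..b j} x * f (\<phi> x y z)))) I"
  shows "I = ((F3 (\<phi> (b j) (b k) (b l)) - F3 (\<phi> (b j) (b k) (a l)))
      - (F3 (\<phi> (b j) (a k) (b l)) - F3 (\<phi> (b j) (a k) (a l))))
    - ((F3 (\<phi> (a j) (b k) (b l)) - F3 (\<phi> (a j) (b k) (a l)))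
      - (F3 (\<phi> (a j) (a k) (b l)) - F3 (\<phi> (a j) (a k) (a l))))"
proof -
  have jkl: "j \<in> {1,2,3}" "k \<in> {1,2,3}" "l \<in> {1,2,3}"
    using p by (auto simp: perm3_def)
  note d = perm3_distinct[OF p]
  have ab: "a j \<le> b j" "a k \<le> b k" "a l \<le> b l"
    using nz[OF jkl(1)] nz[OF jkl(2)] nz[OF jkl(3)] by auto
  have dlphi: "dl (\<phi> x y z) j = v (False, j) - x" "dl (\<phi> x y z) k = v (False, k) - y"
    "dl (\<phi> x y z) l = v (False, l) - z" for x y z
    using d by (simp_all add: \<phi>_def dl_def)
  have upd: "(\<phi> x y z)((True, j) := t) = \<phi> t y z" "(\<phi> x y z)((True, k) := t) = \<phi> x t z"
    "(\<phi> x y z)((True, l) := t) = \<phi> x y t" for x y z t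
    using d by (auto simp: \<phi>_def)
  have 1: "((\<lambda>x. f (\<phi> x y z)) has_integral F1 (\<phi> (b j) y z) - F1 (\<phi> (a j) y z)) {a j..b j}"
    if "y \<noteq> v (False, k)" "z \<noteq> v (False, l)" for y z
    using has_integral_line[OF p, of "\<phi> 0 y z" True F1 f "a j" "b j"] that F(1) cont[of F1] ab
    by (simp add: dlphi upd)
  have 2: "((\<lambda>y. F1 (\<phi> x y z)) has_integral F2 (\<phi> x (b k) z) - F2 (\<phi> x (a k) z)) {a k..b k}"
    if "x \<noteq> v (False, j)" "z \<noteq> v (False, l)" for x z
    using has_integral_line[OF perm3_swap(2)[OF p], of "\<phi> x 0 z" True F2 F1 "a k" "b k"] that F(2) cont[of F2] ab
    by (simp add: dlphi upd)
  have 3: "((\<lambda>z. F2 (\<phi> x y z)) has_integral F3 (\<phi> x y (b l)) - F3 (\<phi> x y (a l))) {a l..b l}"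
    if "x \<noteq> v (False, j)" "y \<noteq> v (False, k)" for x y
    using has_integral_line[OF perm3_swap(5)[OF p], of "\<phi> x y 0" True F3 F2 "a l" "b l"] that F(3) cont[of F3] ab
    by (simp add: dlphi upd)
  have L1: "(LINT x|lborel. indicator {a l..b l} z * (indicator {a k..b k} y *
       (indicator {a j..b j} x * f (\<phi> x y z)))) =
     indicator {a l..b l} z * (indicator {a k..b k} y * (F1 (\<phi> (b j) y z) - F1 (\<phi> (a j) y z)))"
    if yz: "y \<noteq> v (False, k)" "z \<noteq> v (False, l)" for y z
  proof -
    have "dl (\<phi> x y z) \<in> two_nonzero" for x
      using two_nonzeroI[OF p] yz by (simp add: dlphi)
    then have "continuous_on {a j..b j} (\<lambda>x. f (\<phi> x y z))"
      unfolding \<phi>_def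
      by (intro continuous_on_compose2[OF cont[of f]] continuous_intros) auto
    then have "integrable lborel (\<lambda>x. indicator {a j..b j} x * f (\<phi> x y z))"
      using borel_integrable_atLeastAtMost' by (fastforce simp: set_integrable_def)
    then have "(LINT x|lborel. indicator {a j..b j} x * f (\<phi> x y z)) = F1 (\<phi> (b j) y z) - F1 (\<phi> (a j) y z)"
      by (rule lborel_integral_AE_eq) (use 1[OF yz] in auto)
    then show ?thesis by simp
  qed
  have nv: "a j \<noteq> v (False, j)" "b j \<noteq> v (False, j)" "a k \<noteq> v (False, k)" "b k \<noteq> v (False, k)"
    using nz[OF jkl(1)] nz[OF jkl(2)] by auto
  obtain U where U: "integrable lborel U" "I = integral\<^sup>L lborel U"
    "AE z in lborel. integrable lborel (\<lambda>y. LINT x|lborel. indicator {a l..b l} z * (indicator {a k..b k} y *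
       (indicator {a j..b j} x * f (\<phi> x y z)))) \<and>
     U z = (LINT y|lborel. LINT x|lborel. indicator {a l..b l} z * (indicator {a k..b k} y *
       (indicator {a j..b j} x * f (\<phi> x y z))))"
    using I unfolding iterated_integral_def by blast
  have ae: "AE t in lborel. t \<noteq> c" for c :: real
    by (rule AE_lborel_singleton)
  have "AE z in lborel. U z = indicator {a l..b l} z *
     ((F2 (\<phi> (b j) (b k) z) - F2 (\<phi> (b j) (a k) z)) - (F2 (\<phi> (a j) (b k) z) - F2 (\<phi> (a j) (a k) z)))"
    using U(3) ae[of "v (False, l)"]
  proof eventually_elim
    case (elim z)
    let ?D = "(F2 (\<phi> (b j) (b k) z) - F2 (\<phi> (b j) (a k) z)) - (F2 (\<phi> (a j) (b k) z) - F2 (\<phi> (a j) (a k) z))"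
    have "AE y in lborel. (LINT x|lborel. indicator {a l..b l} z * (indicator {a k..b k} y *
       (indicator {a j..b j} x * f (\<phi> x y z)))) =
       indicator {a k..b k} y * (indicator {a l..b l} z * (F1 (\<phi> (b j) y z) - F1 (\<phi> (a j) y z)))"
      using ae[of "v (False, k)"]
    proof eventually_elim
      case (elim y)
      show ?case by (subst L1) (use elim \<open>z \<noteq> _\<close> in simp_all)
    qed
    moreover have "((\<lambda>y. indicator {a l..b l} z * (F1 (\<phi> (b j) y z) - F1 (\<phi> (a j) y z)))
       has_integral indicator {a l..b l} z * ?D) {a k..b k}"
      by (rule has_integral_mult_right[OF has_integral_diff[OF 2 2]]) (rule nv nv[symmetric] elim(2))+
    ultimately have "(LINT y|lborel. LINT x|lborel. indicator {a l..b l} z * (indicator {a k..b k} y *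
       (indicator {a j..b j} x * f (\<phi> x y z)))) = indicator {a l..b l} z * ?D"
      by (rule lborel_integral_AE_eq[OF conjunct1[OF elim(1)]])
    with conjunct2[OF elim(1)] show ?case by (rule trans)
  qed
  moreover have "((\<lambda>z. (F2 (\<phi> (b j) (b k) z) - F2 (\<phi> (b j) (a k) z)) -
     (F2 (\<phi> (a j) (b k) z) - F2 (\<phi> (a j) (a k) z))) has_integral
     ((F3 (\<phi> (b j) (b k) (b l)) - F3 (\<phi> (b j) (b k) (a l)))
      - (F3 (\<phi> (b j) (a k) (b l)) - F3 (\<phi> (b j) (a k) (a l))))
    - ((F3 (\<phi> (a j) (b k) (b l)) - F3 (\<phi> (a j) (b k) (a l)))
      - (F3 (\<phi> (a j) (a k) (b l)) - F3 (\<phi> (a j) (a k) (a l))))) {a l..b l}"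
    by (rule has_integral_diff[OF has_integral_diff[OF 3 3] has_integral_diff[OF 3 3]]) (rule nv)+
  ultimately show ?thesis
    using lborel_integral_AE_eq[OF U(1)] U(2) by simp
qed

section \<open>Configurations of two points and integrals over boxes\<close>

definition ev :: "real \<times> real \<times> real \<Rightarrow> real \<times> real \<times> real \<Rightarrow> bool \<times> nat \<Rightarrow> real" where
  "ev x y = (\<lambda>(s, i). crd (if s then y else x) i)"

lemma crd_simps [simp]: "crd (a, b, c) 1 = a" "crd (a, b, c) (Suc 0) = a" "crd (a, b, c) 2 = b" "crd (a, b, c) 3 = c"
  by (simp_all add: crd_def)

lemma crd_cases: "crd (a, b, c) i = (if i = 1 then a else if i = 2 then b else if i = 3 then c else 0)"
  by (simp add: crd_def)

lemma ev_apply [simp]: "ev x y (False, i) = crd x i" "ev x y (True, i) = crd y i"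
  by (simp_all add: ev_def)

lemma dl_ev [simp]: "dl (ev x y) i = crd x i - crd y i"
  by (simp add: dl_def)

lemma rho_dl_ev: "rho (dl (ev x y)) = sqrt (sqdist3 x y)"
  by (simp add: rho_def sqdist3_def)

lemma ev_upd:
  "(ev x (y1, y2, y3))((True, 1) := t) = ev x (t, y2, y3)"
  "(ev x (y1, y2, y3))((True, 2) := t) = ev x (y1, t, y3)"
  "(ev x (y1, y2, y3))((True, 3) := t) = ev x (y1, y2, t)"
  "(ev (x1, x2, x3) y)((False, 1) := t) = ev (t, x2, x3) y"
  "(ev (x1, x2, x3) y)((False, 2) := t) = ev (x1, t, x3) y"
  "(ev (x1, x2, x3) y)((False, 3) := t) = ev (x1, x2, t) y"
  by (auto simp: ev_def crd_cases fun_eq_iff)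

text \<open>The alternating sum over the eight vertices. It does not depend on the order of the
  coordinates, so all orders of integration lead to this one expression.\<close>

definition box_diff :: "(real \<Rightarrow> real \<Rightarrow> real \<Rightarrow> real) \<Rightarrow> (nat \<Rightarrow> real) \<Rightarrow> (nat \<Rightarrow> real) \<Rightarrow> real" where
  "box_diff \<Phi> a b =
     ((\<Phi> (b 1) (b 2) (b 3) - \<Phi> (b 1) (b 2) (a 3)) - (\<Phi> (b 1) (a 2) (b 3) - \<Phi> (b 1) (a 2) (a 3))) -
     ((\<Phi> (a 1) (b 2) (b 3) - \<Phi> (a 1) (b 2) (a 3)) - (\<Phi> (a 1) (a 2) (b 3) - \<Phi> (a 1) (a 2) (a 3)))"

lemma inner_integral_box:
  assumes p: "(j, k, l) \<in> {(3, 2, 1), (2, 3, 1), (1, 3, 2 :: nat)}"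
    and nz: "\<And>i. i \<in> {1,2,3} \<Longrightarrow> crd x i \<noteq> a i \<and> crd x i \<noteq> b i \<and> a i \<le> b i"
    and F: "antider separated (True, j) F1 f" "antider separated (True, k) F2 F1"
      "antider separated (True, l) F3 F2"
    and cont: "\<And>F. F \<in> {f, F1, F2, F3} \<Longrightarrow> continuous_on {v. dl v \<in> two_nonzero} F"
    and int: "integrable lborel (\<lambda>y. indicator (cuboid a b) y * f (ev x y))"
  shows "(LINT y:cuboid a b|lborel. f (ev x y)) = box_diff (\<lambda>y1 y2 y3. F3 (ev x (y1, y2, y3))) a b"
proof -
  define g where "g y1 y2 y3 = indicator {a 1..b 1} y1 * (indicator {a 2..b 2} y2 *
     (indicator {a 3..b 3} y3 * f (ev x (y1, y2, y3))))" for y1 y2 y3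
  have g: "(\<lambda>y. indicator (cuboid a b) y * f (ev x y)) = (\<lambda>(y1, y2, y3). g y1 y2 y3)"
    by (auto simp: g_def cuboid_def indicator_def)
  have I: "(LINT y:cuboid a b|lborel. f (ev x y)) = (LINT (y1, y2, y3)|lborel. g y1 y2 y3)"
    unfolding set_lebesgue_integral_def g[symmetric] by simp
  have int': "integrable lborel (\<lambda>(y1, y2, y3). g y1 y2 y3)"
    using int unfolding g .
  have nz': "ev x (0, 0, 0) (False, i) \<noteq> a i \<and> ev x (0, 0, 0) (False, i) \<noteq> b i \<and> a i \<le> b i"
    if "i \<in> {1,2,3}" for i
    using nz[OF that] by simp
  have g_def2: "g y1 y2 y3 = indicator {a 1..b 1} y1 * (indicator {a 3..b 3} y3 *
     (indicator {a 2..b 2} y2 * f (ev x (y1, y2, y3))))" for y1 y2 y3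
    by (simp only: g_def mult.left_commute)
  have g_def3: "g y1 y2 y3 = indicator {a 2..b 2} y2 * (indicator {a 3..b 3} y3 *
     (indicator {a 1..b 1} y1 * f (ev x (y1, y2, y3))))" for y1 y2 y3
    by (simp add: g_def mult.left_commute)
  consider "j = 3" "k = 2" "l = 1" | "j = 2" "k = 3" "l = 1" | "j = 1" "k = 3" "l = 2"
    using p by auto
  then show ?thesis
  proof cases
    case 1
    have "perm3 3 2 1" by (auto simp: perm3_def)
    from inner_integral[where a = a and b = b and v = "ev x (0, 0, 0)" and f = f,
        OF this nz' F[unfolded 1] cont, unfolded ev_upd, OF _ _ fubini_321[OF int', folded I, unfolded g_def]]
    show ?thesis by (simp add: box_diff_def)
  next
    case 2
    have "perm3 2 3 1" by (auto simp: perm3_def)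
    from inner_integral[where a = a and b = b and v = "ev x (0, 0, 0)" and f = f,
        OF this nz' F[unfolded 2] cont, unfolded ev_upd, OF _ _ fubini_231[OF int', folded I, unfolded g_def2]]
    show ?thesis by (simp add: box_diff_def)
  next
    case 3
    have "perm3 1 3 2" by (auto simp: perm3_def)
    from inner_integral[where a = a and b = b and v = "ev x (0, 0, 0)" and f = f,
        OF this nz' F[unfolded 3] cont, unfolded ev_upd, OF _ _ fubini_132[OF int', folded I, unfolded g_def3]]
    show ?thesis by (simp add: box_diff_def)
  qed
qed

lemma continuous_on_crd [continuous_intros]:
  "continuous_on A f \<Longrightarrow> continuous_on A (\<lambda>z. crd (f z) i)"
  unfolding crd_def by (cases "i = 1"; cases "i = 2"; cases "i = 3") (auto intro!: continuous_intros)

lemma continuous_on_ev [continuous_intros]: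
  assumes "continuous_on A f" "continuous_on A g"
  shows "continuous_on A (\<lambda>z. ev (f z) (g z))"
proof (rule continuous_on_coordinatewise_then_product)
  show "continuous_on A (\<lambda>z. ev (f z) (g z) p)" for p
    using assms by (cases p; cases "fst p") (auto simp: ev_def intro!: continuous_intros)
qed

lemma antiderivable_Mgen_pull:
  assumes "i \<in> {1,2,3}" "f \<in> qspan (pull Mgen)"
  obtains F where "F \<in> qspan (pull Mgen)" "antider separated (s, i) F f"
  using antiderivable_pull[OF antiderivable_Mgen[OF assms(1)] assms(2), of s]
  unfolding antiderivable_def by blast

text \<open>The integrand is continuous, so Fubini's theorem and \<open>integral_line\<close> apply
  on every line, degenerate or not. \<open>F\<close> is chosen before the box and before
  \<open>y\<close>; this uniformity later makes the coefficients independent of the bounds.\<close>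

lemma outer_integral:
  assumes "f \<in> qspan (pull Mgen)"
  shows "\<exists>F\<in>qspan (pull Mgen). \<forall>a b y. (\<forall>i\<in>{1,2,3}. a i \<le> b i) \<longrightarrow>
    (LINT x:cuboid a b|lborel. f (ev x y)) = box_diff (\<lambda>x1 x2 x3. F (ev (x1, x2, x3) y)) a b"
proof -
  obtain F3 where F3: "F3 \<in> qspan (pull Mgen)" "antider separated (False, 3) F3 f"
    using antiderivable_Mgen_pull[OF _ assms, of 3 False] by auto
  obtain F2 where F2: "F2 \<in> qspan (pull Mgen)" "antider separated (False, 2) F2 F3"
    using antiderivable_Mgen_pull[OF _ F3(1), of 2 False] by auto
  obtain F1 where F1: "F1 \<in> qspan (pull Mgen)" "antider separated (False, 1) F1 F2"
    using antiderivable_Mgen_pull[OF _ F2(1), of 1 False] by auto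
  note cont = continuous_on_pull_Mgen[OF assms] continuous_on_pull_Mgen[OF F3(1)]
    continuous_on_pull_Mgen[OF F2(1)] continuous_on_pull_Mgen[OF F1(1)]
  have "(LINT x:cuboid a b|lborel. f (ev x y)) = box_diff (\<lambda>x1 x2 x3. F1 (ev (x1, x2, x3) y)) a b"
    if ab: "\<forall>i\<in>{1,2,3}. a i \<le> b i" for a b y
  proof -
    have le: "a 1 \<le> b 1" "a 2 \<le> b 2" "a 3 \<le> b 3" using ab by auto
    have 3: "integral {a 3..b 3} (\<lambda>x3. f (ev (x1, x2, x3) y)) = F3 (ev (x1, x2, b 3) y) - F3 (ev (x1, x2, a 3) y)" for x1 x2
      using integral_line[of 3 1 2 False F3 f "a 3" "b 3" "ev (x1, x2, 0) y", OF _ F3(2) cont(2,1) le(3)]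
      by (simp add: ev_upd perm3_def insert_commute del: One_nat_def)
    have 2: "integral {a 2..b 2} (\<lambda>x2. F3 (ev (x1, x2, x3) y)) = F2 (ev (x1, b 2, x3) y) - F2 (ev (x1, a 2, x3) y)" for x1 x3
      using integral_line[of 2 1 3 False F2 F3 "a 2" "b 2" "ev (x1, 0, x3) y", OF _ F2(2) cont(3,2) le(2)]
      by (simp add: ev_upd perm3_def insert_commute del: One_nat_def)
    have 1: "integral {a 1..b 1} (\<lambda>x1. F2 (ev (x1, x2, x3) y)) = F1 (ev (b 1, x2, x3) y) - F1 (ev (a 1, x2, x3) y)" for x2 x3
      using integral_line[of 1 2 3 False F1 F2 "a 1" "b 1" "ev (0, x2, x3) y", OF _ F1(2) cont(4,3) le(1)]
      by (simp add: ev_upd perm3_def insert_commute del: One_nat_def)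
    have I: "(\<lambda>t. F (ev (h t) y)) integrable_on {c..d}"
      if "F \<in> qspan (pull Mgen)" "continuous_on {c..d} h" for F h and c d :: real
      using that(2) by (intro integrable_continuous_real continuous_on_compose2[OF continuous_on_pull_Mgen[OF that(1), of UNIV]]
          continuous_intros) auto
    have hc: "continuous_on A (\<lambda>x. f (ev x y))" for A
      by (intro continuous_on_compose2[OF cont(1)[of UNIV]] continuous_intros) auto
    have cub: "cuboid a b = cbox (a 1, a 2, a 3) (b 1, b 2, b 3)"
      by (simp add: cuboid_def cbox_Pair_eq)
    have "set_integrable lborel (cuboid a b) (\<lambda>x. f (ev x y))"
      unfolding set_integrable_def cub by (intro borel_integrable_compact compact_cbox hc)
    then have "(LINT x:cuboid a b|lborel. f (ev x y)) = integral (cbox (a 1, a 2, a 3) (b 1, b 2, b 3)) (\<lambda>x. f (ev x y))"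
      using set_borel_integral_eq_integral(2) cub by metis
    also have "\<dots> = integral {a 1..b 1} (\<lambda>x1. integral (cbox (a 2, a 3) (b 2, b 3)) (\<lambda>z. f (ev (x1, z) y)))"
      using integral_prod_continuous[OF hc, of "a 1" "(a 2, a 3)" "b 1" "(b 2, b 3)"] by simp
    also have "\<dots> = integral {a 1..b 1} (\<lambda>x1. integral {a 2..b 2} (\<lambda>x2. integral {a 3..b 3} (\<lambda>x3. f (ev (x1, x2, x3) y))))"
    proof (rule integral_cong)
      fix x1
      have "continuous_on (cbox (a 2, a 3) (b 2, b 3)) (\<lambda>z. f (ev (x1, z) y))"
        by (intro continuous_on_compose2[OF cont(1)[of UNIV]] continuous_intros) auto
      from integral_prod_continuous[OF this]
      show "integral (cbox (a 2, a 3) (b 2, b 3)) (\<lambda>z. f (ev (x1, z) y)) =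
          integral {a 2..b 2} (\<lambda>x2. integral {a 3..b 3} (\<lambda>x3. f (ev (x1, x2, x3) y)))" by simp
    qed
    also have "\<dots> = integral {a 1..b 1} (\<lambda>x1. (F2 (ev (x1, b 2, b 3) y) - F2 (ev (x1, a 2, b 3) y))
        - (F2 (ev (x1, b 2, a 3) y) - F2 (ev (x1, a 2, a 3) y)))"
      unfolding 3 by (subst integral_diff) (auto intro!: I F3(1) continuous_intros simp: 2)
    also have "\<dots> = ((F1 (ev (b 1, b 2, b 3) y) - F1 (ev (a 1, b 2, b 3) y)) - (F1 (ev (b 1, a 2, b 3) y) - F1 (ev (a 1, a 2, b 3) y)))
        - ((F1 (ev (b 1, b 2, a 3) y) - F1 (ev (a 1, b 2, a 3) y)) - (F1 (ev (b 1, a 2, a 3) y) - F1 (ev (a 1, a 2, a 3) y)))"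
      by (subst integral_diff integral_diff[of "\<lambda>t. _ (ev _ y)"];
          (intro integrable_diff I F2(1) continuous_intros)?)+ (simp add: 1 del: One_nat_def)
    finally show ?thesis by (simp add: box_diff_def)
  qed
  with F1(1) show ?thesis by blast
qed

section \<open>Integrability of the kernels\<close>

text \<open>The exponent \<open>2 / 3\<close> is below 1, whence integrability, and three such
  factors match the order 2 of the bound on the kernels. The antiderivative
  \<open>- 3 * root 3 (c - t)\<close> is continuous across the pole \<open>t = c\<close>.\<close>

lemma integrable_inverse_root3:
  "integrable lborel (\<lambda>t. indicator {a..b} t * (1 / root 3 (c - t) ^ 2))"
proof (cases "a \<le> b")
  case True
  have "((\<lambda>t. 1 / root 3 (c - t) ^ 2) has_integral - 3 * root 3 (c - b) - - 3 * root 3 (c - a)) {a..b}"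
  proof (rule fundamental_theorem_of_calculus_interior_strong[where S = "{c}"])
    fix t assume "t \<in> {a<..<b} - {c}"
    then have nz: "c - t \<noteq> 0" by auto
    then have "DERIV (root 3) (c - t) :> inverse (3 * root 3 (c - t) ^ 2)"
      using DERIV_odd_real_root[OF _ nz, of 3] by simp
    moreover have "((\<lambda>t. c - t) has_real_derivative - 1) (at t)"
      by (auto intro!: derivative_eq_intros)
    ultimately have "((\<lambda>t. root 3 (c - t)) has_real_derivative inverse (3 * root 3 (c - t) ^ 2) * - 1) (at t)"
      by (rule DERIV_chain2[where g = "\<lambda>t. c - t"])
    then have "((\<lambda>t. - 3 * root 3 (c - t)) has_real_derivative
        - 3 * (inverse (3 * root 3 (c - t) ^ 2) * - 1)) (at t)"
      by (rule DERIV_cmult)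
    moreover have "- 3 * (inverse (3 * w) * - 1) = 1 / w" for w :: real
      by (cases "w = 0") (simp_all add: field_simps)
    ultimately show "((\<lambda>t. - 3 * root 3 (c - t)) has_vector_derivative 1 / root 3 (c - t) ^ 2) (at t)"
      by (simp only: has_real_derivative_iff_has_vector_derivative)
  qed (use True in \<open>auto intro!: continuous_intros\<close>)
  then have "(\<lambda>t. 1 / root 3 (c - t) ^ 2) absolutely_integrable_on {a..b}"
    by (intro nonnegative_absolutely_integrable_1) auto
  then have "integrable lebesgue (\<lambda>t. indicator {a..b} t * (1 / root 3 (c - t) ^ 2))"
    by (simp add: set_integrable_def)
  moreover have "(\<lambda>t. indicator {a..b} t * (1 / root 3 (c - t) ^ 2)) \<in> borel_measurable lborel"
  proof -
    have "root 3 \<in> borel_measurable borel"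
      by (intro borel_measurable_continuous_onI continuous_intros)
    then show ?thesis by measurable
  qed
  ultimately show ?thesis by (simp add: integrable_completion)
qed simp

lemma integrable_lborel_times:
  fixes f :: "real \<Rightarrow> real" and g :: "'b::euclidean_space \<Rightarrow> real"
  assumes "integrable lborel f" "integrable lborel g"
  shows "integrable lborel (\<lambda>(x, y). f x * g y)"
proof -
  have [measurable]: "f \<in> borel_measurable lborel" "g \<in> borel_measurable lborel"
    using assms by auto
  have "integrable (lborel \<Otimes>\<^sub>M lborel) (\<lambda>(x, y). f x * g y)"
    by (rule lborel_pair.Fubini_integrable) (use assms in \<open>auto simp: abs_mult\<close>)
  then show ?thesis by (simp add: lborel_prod)
qed

lemma AE_crd_neq:
  assumes "i \<in> {1,2,3}"
  shows "AE y in lborel. crd y i \<noteq> c"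
proof -
  obtain k :: "real \<times> real \<times> real" where k: "k \<in> Basis" "\<And>y. crd y i = y \<bullet> k"
  proof -
    consider "i = 1" | "i = 2" | "i = 3" using assms by auto
    then show thesis
    proof cases
      case 1 then show ?thesis by (intro that[of "(1, 0, 0)"]) (auto simp: crd_def Basis_prod_def zero_prod_def)
    next
      case 2 then show ?thesis by (intro that[of "(0, 1, 0)"]) (auto simp: crd_def Basis_prod_def zero_prod_def)
    next
      case 3 then show ?thesis by (intro that[of "(0, 0, 1)"]) (auto simp: crd_def Basis_prod_def zero_prod_def)
    qed
  qed
  have "negligible {y. y \<bullet> k = c}" by (rule negligible_standard_hyperplane[OF k(1)])
  then have "AE y in lebesgue. y \<notin> {y. y \<bullet> k = c}"
    by (intro AE_not_in) (simp add: negligible_iff_null_sets)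
  then show ?thesis by (simp add: AE_completion_iff k(2))
qed

text \<open>The bound is a product of locally integrable functions of one variable. The hypothesis excludes
  factors with the junk value \<open>1 / 0 = 0\<close>.\<close>

lemma inverse_sqdist3_le:
  assumes "\<And>i. i \<in> {1,2,3} \<Longrightarrow> crd x i \<noteq> crd y i"
  shows "1 / sqdist3 x y \<le> 1 / root 3 (crd x 1 - crd y 1) ^ 2 *
     (1 / root 3 (crd x 2 - crd y 2) ^ 2 * (1 / root 3 (crd x 3 - crd y 3) ^ 2))"
proof -
  define r where "r = sqrt (sqdist3 x y)"
  have nz: "crd x 1 - crd y 1 \<noteq> 0" "crd x 2 - crd y 2 \<noteq> 0" "crd x 3 - crd y 3 \<noteq> 0"
    using assms[of 1] assms[of 2] assms[of 3] by auto
  have r2: "r ^ 2 = sqdist3 x y" by (simp add: r_def sqdist3_def)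
  have le: "root 3 t ^ 2 \<le> root 3 r ^ 2" if "t ^ 2 \<le> sqdist3 x y" for t
  proof -
    have "\<bar>t\<bar> \<le> r" unfolding r_def using that by (rule real_le_rsqrt[OF _, of "\<bar>t\<bar>", simplified])
    then have "root 3 \<bar>t\<bar> \<le> root 3 r" by simp
    then have "\<bar>root 3 t\<bar> \<le> root 3 r" by (simp add: real_root_abs)
    then show ?thesis by (metis abs_ge_zero power2_abs power_mono)
  qed
  \<comment> \<open>Every difference is at most \<open>r\<close> in modulus, and three factors
    \<open>r^(2/3)\<close> multiply to \<open>r^2\<close>.\<close>
  have "root 3 (crd x 1 - crd y 1) ^ 2 * (root 3 (crd x 2 - crd y 2) ^ 2 * root 3 (crd x 3 - crd y 3) ^ 2)
      \<le> root 3 r ^ 2 * (root 3 r ^ 2 * root 3 r ^ 2)"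
    by (intro mult_mono le) (auto simp: sqdist3_def)
  also have "\<dots> = (root 3 r ^ 3) ^ 2" by (simp add: power_mult[symmetric] power_add[symmetric])
  also have "\<dots> = sqdist3 x y" using r2 by (simp add: odd_real_root_pow)
  finally have "1 / sqdist3 x y \<le> 1 / (root 3 (crd x 1 - crd y 1) ^ 2 * (root 3 (crd x 2 - crd y 2) ^ 2 * root 3 (crd x 3 - crd y 3) ^ 2))"
    using nz by (intro frac_le) auto
  then show ?thesis by simp
qed

text \<open>\<open>1 + 1 / sqdist3 x y\<close> dominates both kernels: the force kernel is at most
  \<open>1 / rho^2\<close> in modulus, and \<open>1 / rho \<le> 1 + 1 / rho^2\<close>.\<close>

lemma integrable_kernel_bound:
  assumes q: "q \<in> borel_measurable borel"
    and C: "\<And>y. y \<in> cuboid a b \<Longrightarrow> \<bar>q y\<bar> \<le> C * (1 + 1 / sqdist3 x y)" and "0 \<le> C"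
  shows "integrable lborel (\<lambda>y. indicator (cuboid a b) y * q y)"
proof -
  let ?h = "\<lambda>i t. indicator {a i..b i} t * (1 / root 3 (crd x i - t) ^ 2) :: real"
  define K where "K = (\<lambda>(y1, y2, y3). ?h 1 y1 * (case (y2, y3) of (y2, y3) \<Rightarrow> ?h 2 y2 * ?h 3 y3))"
  have cub: "cuboid a b = cbox (a 1, a 2, a 3) (b 1, b 2, b 3)"
    by (simp add: cuboid_def cbox_Pair_eq)
  have K: "integrable lborel K"
    unfolding K_def
    using integrable_lborel_times[OF integrable_inverse_root3
        integrable_lborel_times[OF integrable_inverse_root3 integrable_inverse_root3]]
    by (simp add: case_prod_unfold)
  have "integrable lborel (indicator (cuboid a b) :: _ \<Rightarrow> real)"
    unfolding cub by (intro integrable_real_indicator) (auto simp: emeasure_lborel_cbox_eq)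
  then have "integrable lborel (\<lambda>y. C * (indicator (cuboid a b) y + K y))"
    using K by (intro integrable_mult_right Bochner_Integration.integrable_add)
  then show ?thesis
  proof (rule Bochner_Integration.integrable_bound)
    show "(\<lambda>y. indicator (cuboid a b) y * q y) \<in> borel_measurable lborel"
      using q unfolding cub by measurable
    have "AE y in lborel. crd y 1 \<noteq> crd x 1 \<and> crd y 2 \<noteq> crd x 2 \<and> crd y 3 \<noteq> crd x 3"
      by (intro AE_conjI AE_crd_neq) auto
    then show "AE y in lborel. norm (indicator (cuboid a b) y * q y) \<le> norm (C * (indicator (cuboid a b) y + K y))"
    proof eventually_elim
      case (elim y)
      show ?case
      proof (cases "y \<in> cuboid a b")
        case True
        obtain y1 y2 y3 where y: "y = (y1, y2, y3)" by (cases y) auto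
        have "crd x i \<noteq> crd y i" if "i \<in> {1,2,3}" for i
          using that elim by auto
        from inverse_sqdist3_le[OF this] have "1 / sqdist3 x y \<le> K y"
          using True by (simp add: K_def y cuboid_def)
        moreover have "0 \<le> 1 / sqdist3 x y" by (simp add: sqdist3_def)
        ultimately have "C * (1 + 1 / sqdist3 x y) \<le> \<bar>C * (1 + K y)\<bar>"
          using \<open>0 \<le> C\<close> by (simp add: abs_mult mult_left_mono)
        then show ?thesis using C[OF True] True by simp
      qed simp
    qed
  qed
qed

section \<open>The sixfold integral\<close>

definition monomial :: "(nat \<Rightarrow> nat) \<Rightarrow> (nat \<Rightarrow> nat) \<Rightarrow> (bool \<times> nat \<Rightarrow> real) \<Rightarrow> real" where
  "monomial n m v = (v (False, 1) ^ n 1 * v (False, 2) ^ n 2 * v (False, 3) ^ n 3) *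
     (v (True, 1) ^ m 1 * v (True, 2) ^ m 2 * v (True, 3) ^ m 3)"

lemma monomial_ev: "monomial n m (ev x y) = mono3 x n * mono3 y m"
  by (simp add: monomial_def mono3_def)

lemma monomial_qpoly: "monomial n m \<in> qpoly"
  unfolding monomial_def by (intro qpoly_intros)

lemma antiderivative_chain:
  assumes p: "perm3 j k l"
    and g: "\<And>m. antiderivable nonvanishing j (N1gen j) (\<lambda>d. d j ^ m * g d)"
    and f: "f \<in> qspan (pull {g})"
  obtains F1 F2 F3 where "F1 \<in> qspan (pull (N1gen j))" "F2 \<in> qspan (pull (N2gen k))" "F3 \<in> qspan (pull Mgen)"
    "antider separated (True, j) F1 f" "antider separated (True, k) F2 F1" "antider separated (True, l) F3 F2"
proof -
  obtain F1 where F1: "F1 \<in> qspan (pull (N1gen j))" "antider separated (True, j) F1 f"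
    using antiderivable_pull[of "{g}" j "N1gen j" f True] g f by (auto simp: antiderivable_def)
  obtain F2 where F2: "F2 \<in> qspan (pull (N2gen k))" "antider separated (True, k) F2 F1"
    using antiderivable_pull[OF antiderivable_N1gen[OF perm3_swap(2)[OF p]] F1(1), of True]
    by (auto simp: antiderivable_def)
  obtain F3 where F3: "F3 \<in> qspan (pull Mgen)" "antider separated (True, l) F3 F2"
    using antiderivable_pull[OF antiderivable_N2gen[OF perm3_swap(3)[OF p]] F2(1), of True]
    by (auto simp: antiderivable_def)
  show ?thesis by (rule that[OF F1(1) F2(1) F3(1) F1(2) F2(2) F3(2)])
qed

lemma sqdist3_nonneg: "0 \<le> sqdist3 x y"
  by (simp add: sqdist3_def)

text \<open>The inner integral is evaluated for x outside the planes that carry the faces of the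
  second cuboid, a null set. The resulting expression is continuous in x on the whole space, and its
  eight vertex terms are integrated one by one.\<close>

lemma sixfold_integral:
  fixes j k l :: nat
  assumes p: "(j, k, l) \<in> {(3, 2, 1), (2, 3, 1), (1, 3, 2 :: nat)}"
    and g: "\<And>m. antiderivable nonvanishing j (N1gen j) (\<lambda>d. d j ^ m * g d)"
    and cont: "continuous_on two_nonzero g"
    and meas: "(\<lambda>z. g (dl (ev (fst z) (snd z)))) \<in> borel_measurable borel"
    and bound: "\<And>x y. \<bar>g (dl (ev x y))\<bar> \<le> 1 + 1 / sqdist3 x y"
  obtains F where "F \<in> qspan (pull Mgen)"
    "\<And>a b a' b'. (\<And>i. i \<in> {1,2,3} \<Longrightarrow> a i \<le> b i \<and> a' i \<le> b' i) \<Longrightarrow>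
      (LINT x:cuboid a b|lborel. LINT y:cuboid a' b'|lborel. monomial n m (ev x y) * g (dl (ev x y))) =
      box_diff (\<lambda>y1 y2 y3. box_diff (\<lambda>x1 x2 x3. F (ev (x1, x2, x3) (y1, y2, y3))) a b) a' b'"
proof -
  define f where "f v = monomial n m v * g (dl v)" for v
  have p3: "perm3 j k l" using p by (auto simp: perm3_def)
  have "(\<lambda>v. g (dl v)) \<in> pull {g}" by (simp add: pull_def)
  then have f: "f \<in> qspan (pull {g})"
    unfolding f_def by (rule qs_gen[OF monomial_qpoly])
  obtain F1 F2 F3 where F: "F1 \<in> qspan (pull (N1gen j))" "F2 \<in> qspan (pull (N2gen k))" "F3 \<in> qspan (pull Mgen)"
    and A: "antider separated (True, j) F1 f" "antider separated (True, k) F2 F1" "antider separated (True, l) F3 F2"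
    by (rule antiderivative_chain[OF p3 g f])
  have C: "continuous_on {v. dl v \<in> two_nonzero} G" if "G \<in> {f, F1, F2, F3}" for G
  proof -
    have "continuous_on {v. dl v \<in> two_nonzero} f"
      by (rule continuous_on_qspan_pull[OF f, of two_nonzero]) (use cont in auto)
    moreover have "continuous_on {v. dl v \<in> two_nonzero} F1"
      by (rule continuous_on_qspan_pull[OF F(1) continuous_on_N1gen[OF p3]]) auto
    moreover have "continuous_on {v. dl v \<in> two_nonzero} F2"
      by (rule continuous_on_qspan_pull[OF F(2) continuous_on_N2gen[OF perm3_swap(2)[OF p3]]]) auto
    moreover have "continuous_on {v. dl v \<in> two_nonzero} F3"
      by (rule continuous_on_pull_Mgen[OF F(3)])
    ultimately show ?thesis using that by auto
  qed
  obtain G where G: "G \<in> qspan (pull Mgen)" and outer: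
    "\<forall>a b y. (\<forall>i\<in>{1,2,3}. a i \<le> b i) \<longrightarrow>
      (LINT x:cuboid a b|lborel. F3 (ev x y)) = box_diff (\<lambda>x1 x2 x3. G (ev (x1, x2, x3) y)) a b"
    using outer_integral[OF F(3)] by blast
  have "continuous_on UNIV (\<lambda>z. monomial n m (ev (fst z) (snd z)))"
    by (intro continuous_on_compose2[OF continuous_on_qpoly[OF monomial_qpoly, of UNIV]] continuous_intros) auto
  then have fmeas: "(\<lambda>z. f (ev (fst z) (snd z))) \<in> borel_measurable borel"
    unfolding f_def by (intro borel_measurable_times meas borel_measurable_continuous_onI)
  have sec: "(\<lambda>y. f (ev x y)) \<in> borel_measurable borel" for x
  proof -
    have "(\<lambda>y. (x, y)) \<in> borel \<rightarrow>\<^sub>M borel"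
      by (intro borel_measurable_continuous_onI continuous_intros)
    from measurable_compose[OF this fmeas] show ?thesis by simp
  qed
  have cub: "cuboid a b = cbox (a 1, a 2, a 3) (b 1, b 2, b 3)" for a b
    by (simp add: cuboid_def cbox_Pair_eq)
  have int: "integrable lborel (\<lambda>y. indicator (cuboid a b) y * f (ev x y))" for x a b
  proof -
    have "continuous_on (cuboid a b) (\<lambda>y. monomial n m (ev x y))"
      by (intro continuous_on_compose2[OF continuous_on_qpoly[OF monomial_qpoly, of UNIV]] continuous_intros) auto
    then have "bounded ((\<lambda>y. monomial n m (ev x y)) ` cuboid a b)"
      by (intro compact_imp_bounded compact_continuous_image) (auto simp: cub)
    then obtain C where C: "\<And>y. y \<in> cuboid a b \<Longrightarrow> \<bar>monomial n m (ev x y)\<bar> \<le> C"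
      by (auto simp: bounded_iff)
    have "\<bar>f (ev x y)\<bar> \<le> max 0 C * (1 + 1 / sqdist3 x y)" if "y \<in> cuboid a b" for y
      unfolding f_def abs_mult using C[OF that] by (intro mult_mono bound) auto
    from integrable_kernel_bound[OF sec this] show ?thesis by simp
  qed
  have "(LINT x:cuboid a b|lborel. LINT y:cuboid a' b'|lborel. f (ev x y)) =
      box_diff (\<lambda>y1 y2 y3. box_diff (\<lambda>x1 x2 x3. G (ev (x1, x2, x3) (y1, y2, y3))) a b) a' b'"
    if ab: "\<And>i. i \<in> {1,2,3} \<Longrightarrow> a i \<le> b i \<and> a' i \<le> b' i" for a b a' b'
  proof -
    let ?D = "\<lambda>x. box_diff (\<lambda>y1 y2 y3. F3 (ev x (y1, y2, y3))) a' b'"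
    have outer': "(LINT x:cuboid a b|lborel. F3 (ev x y)) = box_diff (\<lambda>x1 x2 x3. G (ev (x1, x2, x3) y)) a b" for y
      using outer ab by blast
    have hc: "continuous_on A (\<lambda>x. F3 (ev x y))" for A y
      by (intro continuous_on_compose2[OF continuous_on_pull_Mgen[OF F(3), of UNIV]] continuous_intros) auto
    have ic: "set_integrable lborel (cuboid a b) (\<lambda>x. F3 (ev x y))" for y
      unfolding set_integrable_def cub by (intro borel_integrable_compact compact_cbox hc)
    have "(LINT x:cuboid a b|lborel. LINT y:cuboid a' b'|lborel. f (ev x y)) = (LINT x:cuboid a b|lborel. ?D x)"
      unfolding set_lebesgue_integral_def[of lborel "cuboid a b"]
    proof (rule integral_cong_AE)
      \<comment> \<open>The two integrands agree only almost everywhere, so measurability of the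
        inner integral in x has to come from joint measurability of \<open>f\<close>.\<close>
      have "(\<lambda>z. indicator (cuboid a' b') (snd z) *\<^sub>R f (ev (fst z) (snd z))) \<in> borel_measurable (borel :: ((real \<times> real \<times> real) \<times> real \<times> real \<times> real) measure)"
      proof (intro borel_measurable_scaleR fmeas)
        have "snd \<in> (borel :: ((real \<times> real \<times> real) \<times> real \<times> real \<times> real) measure) \<rightarrow>\<^sub>M borel"
          by (intro borel_measurable_continuous_onI continuous_intros)
        then show "(\<lambda>z. indicat_real (cuboid a' b') (snd z)) \<in> borel_measurable (borel :: ((real \<times> real \<times> real) \<times> real \<times> real \<times> real) measure)"
          by (rule measurable_compose) (simp add: cub)
      qed
      then have "(\<lambda>(x, y). indicator (cuboid a' b') y *\<^sub>R f (ev x y)) \<in> borel_measurable (lborel \<Otimes>\<^sub>M lborel)"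
        by (simp add: lborel_prod case_prod_unfold)
      then have "(\<lambda>x. LINT y:cuboid a' b'|lborel. f (ev x y)) \<in> borel_measurable lborel"
        unfolding set_lebesgue_integral_def by (rule lborel.borel_measurable_lebesgue_integral)
      then show "(\<lambda>x. indicator (cuboid a b) x *\<^sub>R (LINT y:cuboid a' b'|lborel. f (ev x y))) \<in> borel_measurable lborel"
        by (intro borel_measurable_scaleR) (auto simp: cub)
      have "?D \<in> borel_measurable borel"
        unfolding box_diff_def by (intro borel_measurable_continuous_onI continuous_intros hc)
      then show "(\<lambda>x. indicator (cuboid a b) x *\<^sub>R ?D x) \<in> borel_measurable lborel"
        by (intro borel_measurable_scaleR) (auto simp: cub)
      have "AE x in lborel. (crd x 1 \<noteq> a' 1 \<and> crd x 1 \<noteq> b' 1) \<and> (crd x 2 \<noteq> a' 2 \<and> crd x 2 \<noteq> b' 2) \<and> (crd x 3 \<noteq> a' 3 \<and> crd x 3 \<noteq> b' 3)"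
        by (intro AE_conjI AE_crd_neq) auto
      then show "AE x in lborel. indicator (cuboid a b) x *\<^sub>R (LINT y:cuboid a' b'|lborel. f (ev x y)) = indicator (cuboid a b) x *\<^sub>R ?D x"
      proof eventually_elim
        case (elim x)
        have "crd x i \<noteq> a' i \<and> crd x i \<noteq> b' i \<and> a' i \<le> b' i" if "i \<in> {1,2,3}" for i
          using that elim ab[OF that] by auto
        from inner_integral_box[OF p this A C int] show ?case by simp
      qed
    qed
    also have "\<dots> = box_diff (\<lambda>y1 y2 y3. LINT x:cuboid a b|lborel. F3 (ev x (y1, y2, y3))) a' b'"
      unfolding box_diff_def by (simp only: set_integral_diff ic)
    finally show ?thesis by (simp only: outer')
  qed
  with G show ?thesis by (intro that[of G]) (simp_all only: f_def)
qed

section \<open>Evaluation at the vertices\<close>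

text \<open>One family of coefficients serves all bounds, even unordered ones: only vertex
  evaluations are represented, not integrals.\<close>

definition vertex_combination ::
  "((nat \<Rightarrow> real) \<Rightarrow> (nat \<Rightarrow> real) \<Rightarrow> (nat \<Rightarrow> real) \<Rightarrow> (nat \<Rightarrow> real) \<Rightarrow> real) \<Rightarrow> bool" where
  "vertex_combination \<Phi> \<longleftrightarrow> (\<exists>coef. (\<forall>k \<sigma> S S'. coef k \<sigma> S S' \<in> qpoly) \<and>
     (\<forall>a b a' b'. \<Phi> a b a' b' = lincomb coef a b a' b'))"

lemma lincomb_add:
  "lincomb (\<lambda>k \<sigma> S S' v. c k \<sigma> S S' v + e k \<sigma> S S' v) a b a' b' = lincomb c a b a' b' + lincomb e a b a' b'"
  unfolding lincomb_def sum.distrib[symmetric]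
  by (intro sum.cong refl) (simp add: distrib_right)

lemma lincomb_diff:
  "lincomb (\<lambda>k \<sigma> S S' v. c k \<sigma> S S' v - e k \<sigma> S S' v) a b a' b' = lincomb c a b a' b' - lincomb e a b a' b'"
  unfolding lincomb_def sum_subtractf[symmetric]
  by (intro sum.cong refl) (simp add: left_diff_distrib)

lemma vertex_combination_add:
  assumes "vertex_combination \<Phi>" "vertex_combination \<Psi>"
  shows "vertex_combination (\<lambda>a b a' b'. \<Phi> a b a' b' + \<Psi> a b a' b')"
proof -
  obtain c e where "\<forall>k \<sigma> S S'. c k \<sigma> S S' \<in> qpoly" "\<forall>k \<sigma> S S'. e k \<sigma> S S' \<in> qpoly"
    "\<forall>a b a' b'. \<Phi> a b a' b' = lincomb c a b a' b'" "\<forall>a b a' b'. \<Psi> a b a' b' = lincomb e a b a' b'"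
    using assms unfolding vertex_combination_def by blast
  then show ?thesis
    unfolding vertex_combination_def
    by (intro exI[of _ "\<lambda>k \<sigma> S S' v. c k \<sigma> S S' v + e k \<sigma> S S' v"]) (auto simp: lincomb_add intro!: qp_add)
qed

lemma vertex_combination_diff:
  assumes "vertex_combination \<Phi>" "vertex_combination \<Psi>"
  shows "vertex_combination (\<lambda>a b a' b'. \<Phi> a b a' b' - \<Psi> a b a' b')"
proof -
  obtain c e where "\<forall>k \<sigma> S S'. c k \<sigma> S S' \<in> qpoly" "\<forall>k \<sigma> S S'. e k \<sigma> S S' \<in> qpoly"
    "\<forall>a b a' b'. \<Phi> a b a' b' = lincomb c a b a' b'" "\<forall>a b a' b'. \<Psi> a b a' b' = lincomb e a b a' b'"
    using assms unfolding vertex_combination_def by blast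
  then show ?thesis
    unfolding vertex_combination_def
    by (intro exI[of _ "\<lambda>k \<sigma> S S' v. c k \<sigma> S S' v - e k \<sigma> S S' v"]) (auto simp: lincomb_diff intro!: qpoly_diff)
qed

lemma sum_eq_single:
  fixes f :: "'a \<Rightarrow> real"
  assumes "finite A" "x \<in> A" "\<And>y. y \<in> A \<Longrightarrow> y \<noteq> x \<Longrightarrow> f y = 0"
  shows "sum f A = f x"
  using sum.remove[OF assms(1,2), of f] assms(3) by (simp add: sum.neutral)

lemma vertex_combination_term:
  assumes "p \<in> qpoly" "k \<in> {0,1,2}" "\<sigma> permutes {1,2,3}" "S \<subseteq> {1,2,3}" "S' \<subseteq> {1,2,3}"
  shows "vertex_combination (\<lambda>a b a' b'. if delta a b a' b' \<sigma> S S' 1 \<noteq> 0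
    then p (bounds_env a b a' b') * basic_term k (delta a b a' b' \<sigma> S S') else 0)"
proof -
  \<comment> \<open>The family supported at the single index
    \<open>(k, \<sigma>, S, S')\<close>.\<close>
  define c where "c k' \<sigma>' T T' = (if k' = k \<and> \<sigma>' = \<sigma> \<and> T = S \<and> T' = S' then p else (\<lambda>_. 0))" for k' \<sigma>' T T'
  have "c k' \<sigma>' T T' \<in> qpoly" for k' \<sigma>' T T'
    using assms(1) by (auto simp: c_def intro: qp_const)
  moreover have "lincomb c a b a' b' = (if delta a b a' b' \<sigma> S S' 1 \<noteq> 0
    then p (bounds_env a b a' b') * basic_term k (delta a b a' b' \<sigma> S S') else 0)" for a b a' b'
  proof -
    define t where "t k' \<sigma>' T T' = (if delta a b a' b' \<sigma>' T T' 1 \<noteq> 0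
      then c k' \<sigma>' T T' (bounds_env a b a' b') * basic_term k' (delta a b a' b' \<sigma>' T T') else 0)" for k' \<sigma>' T T'
    have t0: "t k' \<sigma>' T T' = 0" if "\<not> (k' = k \<and> \<sigma>' = \<sigma> \<and> T = S \<and> T' = S')" for k' \<sigma>' T T'
      using that by (auto simp: t_def c_def)
    have "lincomb c a b a' b' =
        (\<Sum>k'\<in>{0,1,2}. \<Sum>\<sigma>'\<in>{\<sigma>. \<sigma> permutes {1,2,3}}. \<Sum>T\<in>Pow {1,2,3}. \<Sum>T'\<in>Pow {1,2,3}. t k' \<sigma>' T T')"
      by (simp only: lincomb_def t_def)
    also have "\<dots> = (\<Sum>\<sigma>'\<in>{\<sigma>. \<sigma> permutes {1,2,3}}. \<Sum>T\<in>Pow {1,2,3}. \<Sum>T'\<in>Pow {1,2,3}. t k \<sigma>' T T')"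
      by (rule sum_eq_single) (use assms(2) in \<open>auto intro!: sum.neutral t0\<close>)
    also have "\<dots> = (\<Sum>T\<in>Pow {1,2,3}. \<Sum>T'\<in>Pow {1,2,3}. t k \<sigma> T T')"
      by (rule sum_eq_single) (use assms(3) in \<open>auto intro!: sum.neutral t0 finite_permutations\<close>)
    also have "\<dots> = (\<Sum>T'\<in>Pow {1,2,3}. t k \<sigma> S T')"
      by (rule sum_eq_single) (use assms(4) in \<open>auto intro!: sum.neutral t0\<close>)
    also have "\<dots> = t k \<sigma> S S'"
      by (rule sum_eq_single) (use assms(5) in \<open>auto intro!: t0\<close>)
    finally show ?thesis by (simp only: t_def c_def simp_thms if_True)
  qed
  ultimately show ?thesis
    unfolding vertex_combination_def by (intro exI[of _ c]) auto
qed

text \<open>Equal to the identity outside \<open>{1,2,3}\<close>, as \<open>permutes\<close>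
  demands.\<close>

definition arrange :: "nat \<Rightarrow> nat \<Rightarrow> nat \<Rightarrow> nat \<Rightarrow> nat" where
  "arrange i j k = (\<lambda>n. if n = 1 then i else if n = 2 then j else if n = 3 then k else n)"

lemma arrange_permutes:
  assumes "perm3 i j k"
  shows "arrange i j k permutes {1,2,3}"
proof (rule bij_imp_permutes)
  have "inj_on (arrange i j k) {1,2,3}"
    using perm3_distinct[OF assms] by (auto simp: inj_on_def arrange_def)
  moreover have "arrange i j k ` {1,2,3} = {1,2,3}"
    using assms by (auto simp: arrange_def perm3_def)
  ultimately show "bij_betw (arrange i j k) {1,2,3} {1,2,3}" by (simp add: bij_betw_def)
qed (auto simp: arrange_def)

definition vpoint :: "(nat \<Rightarrow> real) \<Rightarrow> (nat \<Rightarrow> real) \<Rightarrow> nat set \<Rightarrow> real \<times> real \<times> real" where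
  "vpoint a b S = (vtx a b S 1, vtx a b S 2, vtx a b S 3)"

lemma crd_vpoint: "crd (vpoint a b S) i = (if i \<in> {1,2,3} then vtx a b S i else 0)"
  by (auto simp: vpoint_def crd_cases)

lemma rho_permuted:
  assumes "perm3 i j k" "e 1 = d i" "e 2 = d j" "e 3 = d k"
  shows "rho e = rho d"
  unfolding rho_perm3[OF assms(1), of d] by (simp only: rho_def assms(2-4))

text \<open>\<open>arrange\<close> moves the coordinate that multiplies the generator to the first
  place, so the case distinction in \<open>lincomb\<close> is exactly on the vanishing of that
  factor.\<close>

lemma vertex_combination_Mgen:
  assumes c: "c \<in> qpoly" and g: "g \<in> Mgen" and S: "S \<subseteq> {1,2,3}" "S' \<subseteq> {1,2,3}"
  shows "vertex_combination (\<lambda>a b a' b'. c (ev (vpoint a b S) (vpoint a' b' S')) *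
    g (dl (ev (vpoint a b S) (vpoint a' b' S'))))"
proof -
  \<comment> \<open>\<open>s\<close> expresses the coordinates of the two vertices through the
    bounds, which turns polynomials in the coordinates into polynomials in the bounds.\<close>
  define s where "s u = (\<lambda>(t, i). if i \<in> {1,2,3} then
      (if t then u (if i \<in> S' then 3 else 2, i) else u (if i \<in> S then 1 else 0, i)) else 0)"
    for u :: "nat \<times> nat \<Rightarrow> real"
  have s: "s (bounds_env a b a' b') = ev (vpoint a b S) (vpoint a' b' S')" for a b a' b'
    by (auto simp: s_def ev_def fun_eq_iff crd_vpoint vtx_def bounds_env_def)
  have s_qpoly: "(\<lambda>u. s u q) \<in> qpoly" for q
  proof (cases q)
    case (Pair t i)
    then show ?thesis
      by (cases "i \<in> {1,2,3}"; cases t) (simp_all add: s_def qp_var qp_const del: One_nat_def)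
  qed
  define D where "D a b a' b' = dl (ev (vpoint a b S) (vpoint a' b' S'))" for a b a' b'
  have dl_qpoly: "(\<lambda>u. dl (s u) i) \<in> qpoly" for i
    unfolding dl_def by (intro qpoly_diff s_qpoly)
  have cs: "(\<lambda>u. c (s u)) \<in> qpoly" by (rule qpoly_subst[OF c s_qpoly])
  have delta: "delta a b a' b' (arrange i j k) S S' 1 = D a b a' b' i"
      "delta a b a' b' (arrange i j k) S S' 2 = D a b a' b' j"
      "delta a b a' b' (arrange i j k) S S' 3 = D a b a' b' k"
    if "perm3 i j k" for i j k a b a' b'
  proof -
    have "i \<in> {1,2,3}" "j \<in> {1,2,3}" "k \<in> {1,2,3}" using that by (auto simp: perm3_def)
    then show "delta a b a' b' (arrange i j k) S S' 1 = D a b a' b' i"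
      "delta a b a' b' (arrange i j k) S S' 2 = D a b a' b' j"
      "delta a b a' b' (arrange i j k) S S' 3 = D a b a' b' k"
      by (simp_all add: delta_def D_def crd_vpoint arrange_def del: One_nat_def)
  qed
  have rho_delta: "rho (delta a b a' b' (arrange i j k) S S') = rho (D a b a' b')"
    if "perm3 i j k" for i j k a b a' b'
    by (rule rho_permuted[OF that delta[OF that]])
  have T: "vertex_combination (\<lambda>a b a' b'. c (ev (vpoint a b S) (vpoint a' b' S')) *
      (D a b a' b' i ^ Suc e * basic_term q (delta a b a' b' (arrange i j k) S S')))"
    if p: "perm3 i j k" and q: "q \<in> {0,1,2}" for i j k q e
  proof -
    have "(\<lambda>u. c (s u) * dl (s u) i ^ Suc e) \<in> qpoly"
      by (intro qpoly_intros cs dl_qpoly)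
    from vertex_combination_term[OF this q arrange_permutes[OF p] S]
    show ?thesis
      unfolding delta[OF p] s D_def[symmetric]
      by (rule back_subst[of vertex_combination]) (auto simp: fun_eq_iff)
  qed
  consider "g = rho"
    | i j k where "perm3 i j k" "g = (\<lambda>d. d i * artanh (d k / rho d))"
    | i j k where "perm3 i j k" "g = (\<lambda>d. d i * arctan (d j * d k / (d i * rho d)))"
    using g unfolding Mgen_def by blast
  then show ?thesis
  proof cases
    case 1
    have p: "perm3 1 2 3" "perm3 2 1 3" "perm3 3 1 2" by (auto simp: perm3_def)
    \<comment> \<open>Each square gets an arrangement led by its own coordinate. The identity
      persists at \<open>rho d = 0\<close>, where \<open>x / 0 = 0\<close> makes both sides
      vanish.\<close>
    have r: "rho d = d 1 ^ Suc 1 * (1 / rho d) + (d 2 ^ Suc 1 * (1 / rho d) + d 3 ^ Suc 1 * (1 / rho d))" for d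
    proof -
      have "rho d = rho d ^ 2 / rho d" by (simp add: power2_eq_square)
      also have "\<dots> = (d 1 ^ 2 + d 2 ^ 2 + d 3 ^ 2) / rho d" by (simp add: rho_def)
      finally show ?thesis by (simp add: add_divide_distrib power2_eq_square)
    qed
    have "vertex_combination (\<lambda>a b a' b'.
       c (ev (vpoint a b S) (vpoint a' b' S')) * (D a b a' b' 1 ^ Suc 1 * basic_term 0 (delta a b a' b' (arrange 1 2 3) S S')) +
       (c (ev (vpoint a b S) (vpoint a' b' S')) * (D a b a' b' 2 ^ Suc 1 * basic_term 0 (delta a b a' b' (arrange 2 1 3) S S')) +
        c (ev (vpoint a b S) (vpoint a' b' S')) * (D a b a' b' 3 ^ Suc 1 * basic_term 0 (delta a b a' b' (arrange 3 1 2) S S'))))"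
      by (intro vertex_combination_add T p) auto
    then show ?thesis
    proof (rule back_subst[of vertex_combination], intro ext)
      fix a b a' b'
      show "c (ev (vpoint a b S) (vpoint a' b' S')) * (D a b a' b' 1 ^ Suc 1 * basic_term 0 (delta a b a' b' (arrange 1 2 3) S S')) +
       (c (ev (vpoint a b S) (vpoint a' b' S')) * (D a b a' b' 2 ^ Suc 1 * basic_term 0 (delta a b a' b' (arrange 2 1 3) S S')) +
        c (ev (vpoint a b S) (vpoint a' b' S')) * (D a b a' b' 3 ^ Suc 1 * basic_term 0 (delta a b a' b' (arrange 3 1 2) S S'))) =
        c (ev (vpoint a b S) (vpoint a' b' S')) * g (dl (ev (vpoint a b S) (vpoint a' b' S')))"
        unfolding D_def[symmetric] 1 basic_term_def rho_delta[OF p(1)] rho_delta[OF p(2)] rho_delta[OF p(3)]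
        by (subst (4) r) (simp only: if_True simp_thms distrib_left)
    qed
  next
    case (2 i j k)
    from T[OF 2(1), of 1 0] show ?thesis
      unfolding 2(2) by (simp add: basic_term_def rho_delta[OF 2(1)] delta[OF 2(1), simplified] delta[OF 2(1)] D_def[symmetric])
  next
    case (3 i j k)
    from T[OF 3(1), of 2 0] show ?thesis
      unfolding 3(2) by (simp add: basic_term_def rho_delta[OF 3(1)] delta[OF 3(1), simplified] delta[OF 3(1)] D_def[symmetric])
  qed
qed

lemma vertex_combination_vertex:
  assumes "F \<in> qspan (pull Mgen)" "S \<subseteq> {1,2,3}" "S' \<subseteq> {1,2,3}"
  shows "vertex_combination (\<lambda>a b a' b'. F (ev (vpoint a b S) (vpoint a' b' S')))"
  using assms(1)
proof induction
  case (qs_gen c h)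
  then obtain g where "g \<in> Mgen" "h = (\<lambda>v. g (dl v))" by (auto simp: pull_def)
  with vertex_combination_Mgen[OF qs_gen(1) _ assms(2,3)] show ?case by simp
next
  case (qs_add f g)
  from qs_add.IH show ?case by (rule vertex_combination_add)
qed

text \<open>The corners \<open>e\<close> and \<open>e'\<close> are kept abstract so that the rule
  applies to the box of y and then to the box of x.\<close>

lemma vertex_combination_box_diff:
  assumes "\<And>S. S \<subseteq> {1,2,3} \<Longrightarrow> vertex_combination (\<lambda>a b a' b'. \<Phi> a b a' b' (vpoint (e a b a' b') (e' a b a' b') S))"
  shows "vertex_combination (\<lambda>a b a' b'. box_diff (\<lambda>x1 x2 x3. \<Phi> a b a' b' (x1, x2, x3)) (e a b a' b') (e' a b a' b'))"
proof -
  have L: "vertex_combination (\<lambda>a b a' b'. \<Phi> a b a' b' (if s1 then e' a b a' b' 1 else e a b a' b' 1,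
      if s2 then e' a b a' b' 2 else e a b a' b' 2, if s3 then e' a b a' b' 3 else e a b a' b' 3))" for s1 s2 s3
    \<comment> \<open>The vertex that takes the upper bound in exactly those coordinates whose flag
      is true.\<close>
    using assms[of "{i \<in> {1,2,3}. i = 1 \<and> s1 \<or> i = 2 \<and> s2 \<or> i = 3 \<and> s3}", OF Collect_restrict]
    by (simp add: vpoint_def vtx_def del: One_nat_def)
  note L' = L[of True True True] L[of True True False] L[of True False True] L[of True False False]
    L[of False True True] L[of False True False] L[of False False True] L[of False False False]
  show ?thesis
    unfolding box_diff_def by (intro vertex_combination_diff L'[unfolded if_True if_False])
qed

lemma vertex_combination_sixfold:
  assumes "F \<in> qspan (pull Mgen)"
  shows "vertex_combination (\<lambda>a b a' b'.
    box_diff (\<lambda>y1 y2 y3. box_diff (\<lambda>x1 x2 x3. F (ev (x1, x2, x3) (y1, y2, y3))) a b) a' b')"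
  by (rule vertex_combination_box_diff[of "\<lambda>a b a' b' y. box_diff (\<lambda>x1 x2 x3. F (ev (x1, x2, x3) y)) a b" "\<lambda>a b a' b'. a'" "\<lambda>a b a' b'. b'"],
      rule vertex_combination_box_diff[of "\<lambda>a b a' b' x. F (ev x (vpoint a' b' _))" "\<lambda>a b a' b'. a" "\<lambda>a b a' b'. b"])
    (rule vertex_combination_vertex[OF assms])

section \<open>The potential and the force\<close>

lemma continuous_on_rho_dl_ev: "continuous_on UNIV (\<lambda>z. rho (dl (ev (fst z) (snd z))))"
  by (intro continuous_on_compose2[OF continuous_on_rho[of UNIV]] continuous_on_compose2[OF continuous_on_dl[of UNIV]]
      continuous_intros) auto

lemma two_nonzero_rho: "d \<in> two_nonzero \<Longrightarrow> rho d \<noteq> 0"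
  using two_nonzeroD(2)[of 1 2 3 d] by (simp add: perm3_def)

lemma vertex_combination_coefficients:
  assumes "vertex_combination \<Phi>"
    and eq: "\<And>a b a' b'. \<forall>i\<in>{1,2,3}. a i < b i \<and> a' i < b' i \<Longrightarrow> \<Psi> a b a' b' = \<Phi> a b a' b'"
  shows "\<exists>coef. (\<forall>k \<sigma> S S'. coef k \<sigma> S S' \<in> qpoly) \<and>
    (\<forall>a b a' b'. (\<forall>i\<in>{1,2,3}. a i < b i \<and> a' i < b' i) \<longrightarrow> \<Psi> a b a' b' = lincomb coef a b a' b')"
proof -
  obtain coef where "\<forall>k \<sigma> S S'. coef k \<sigma> S S' \<in> qpoly" "\<forall>a b a' b'. \<Phi> a b a' b' = lincomb coef a b a' b'"
    using assms(1) unfolding vertex_combination_def by blast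
  with eq show ?thesis by (intro exI[of _ coef]) auto
qed

lemma Vpot_lincomb:
  "\<exists>coef. (\<forall>k \<sigma> S S'. coef k \<sigma> S S' \<in> qpoly) \<and>
    (\<forall>a b a' b'. (\<forall>i\<in>{1,2,3}. a i < b i \<and> a' i < b' i) \<longrightarrow> Vpot a b a' b' n m = lincomb coef a b a' b')"
proof -
  have p: "perm3 3 2 1" by (auto simp: perm3_def)
  have cont: "continuous_on two_nonzero (\<lambda>d. 1 / rho d)"
    using two_nonzero_rho by (intro continuous_intros) auto
  have meas: "(\<lambda>z. 1 / rho (dl (ev (fst z) (snd z)))) \<in> borel_measurable borel"
    by (intro borel_measurable_divide borel_measurable_continuous_onI continuous_on_rho_dl_ev continuous_intros)
  have bound: "\<bar>1 / rho (dl (ev x y))\<bar> \<le> 1 + 1 / sqdist3 x y" for x y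
  proof -
    \<comment> \<open>To be used with \<open>t = 1 / rho\<close>; for \<open>x = y\<close> the
      convention \<open>1 / 0 = 0\<close> keeps the bound true.\<close>
    have "t \<le> 1 + t ^ 2" if "0 \<le> t" for t :: real
      using zero_le_power2[of "t - 1"] that by (simp add: power2_diff)
    from this[of "1 / sqrt (sqdist3 x y)"] show ?thesis
      by (simp add: rho_dl_ev power_divide sqdist3_nonneg)
  qed
  obtain F where F: "F \<in> qspan (pull Mgen)"
    "\<And>a b a' b'. (\<And>i. i \<in> {1,2,3} \<Longrightarrow> a i \<le> b i \<and> a' i \<le> b' i) \<Longrightarrow>
      (LINT x:cuboid a b|lborel. LINT y:cuboid a' b'|lborel. monomial n m (ev x y) * (1 / rho (dl (ev x y)))) =
      box_diff (\<lambda>y1 y2 y3. box_diff (\<lambda>x1 x2 x3. F (ev (x1, x2, x3) (y1, y2, y3))) a b) a' b'"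
    using sixfold_integral[of 3 2 1 "\<lambda>d. 1 / rho d", OF _ antiderivable_potential_kernel[OF p] cont meas bound, of n m]
    by auto
  have "Vpot a b a' b' n m =
      (LINT x:cuboid a b|lborel. LINT y:cuboid a' b'|lborel. monomial n m (ev x y) * (1 / rho (dl (ev x y))))" for a b a' b'
    by (simp add: Vpot_def monomial_ev rho_dl_ev)
  then show ?thesis
    by (intro vertex_combination_coefficients[OF vertex_combination_sixfold[OF F(1)]])
      (simp only: F(2) less_imp_le)
qed

lemma Fforce_lincomb:
  assumes "j \<in> {1,2,3}"
  shows "\<exists>coef. (\<forall>k \<sigma> S S'. coef k \<sigma> S S' \<in> qpoly) \<and>
    (\<forall>a b a' b'. (\<forall>i\<in>{1,2,3}. a i < b i \<and> a' i < b' i) \<longrightarrow> Fforce j a b a' b' n m = lincomb coef a b a' b')"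
proof -
  \<comment> \<open>The listed triples begin with each direction once; the force needs its own
    direction \<open>j\<close> innermost.\<close>
  obtain k l :: nat where kl: "(j, k, l) \<in> {(3, 2, 1), (2, 3, 1), (1, 3, 2 :: nat)}"
    using assms by auto
  then have p: "perm3 j k l" by (auto simp: perm3_def)
  have cont: "continuous_on two_nonzero (\<lambda>d. d j / rho d ^ 3)"
    using two_nonzero_rho by (intro continuous_intros) auto
  have "continuous_on UNIV (\<lambda>z. dl (ev (fst z) (snd z)) j)"
    unfolding dl_ev by (intro continuous_intros)
  then have meas: "(\<lambda>z. dl (ev (fst z) (snd z)) j / rho (dl (ev (fst z) (snd z))) ^ 3) \<in> borel_measurable borel"
    by (intro borel_measurable_divide borel_measurable_power borel_measurable_continuous_onI continuous_on_rho_dl_ev)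
  have bound: "\<bar>dl (ev x y) j / rho (dl (ev x y)) ^ 3\<bar> \<le> 1 + 1 / sqdist3 x y" for x y
  proof -
    define d where "d = dl (ev x y)"
    have "\<bar>d j\<bar> \<le> rho d"
      by (simp add: rho_perm3[OF p] real_le_rsqrt)
    then have "\<bar>d j\<bar> / rho d ^ 3 \<le> rho d / rho d ^ 3"
      using rho_nonneg[of d] by (intro divide_right_mono) auto
    also have "\<dots> = 1 / rho d ^ 2"
      by (simp add: power2_eq_square power3_eq_cube)
    also have "\<dots> = 1 / sqdist3 x y"
      by (simp add: d_def rho_dl_ev sqdist3_nonneg)
    finally show ?thesis
      using rho_nonneg[of d] by (simp add: d_def[symmetric] abs_divide)
  qed
  obtain F where F: "F \<in> qspan (pull Mgen)"
    "\<And>a b a' b'. (\<And>i. i \<in> {1,2,3} \<Longrightarrow> a i \<le> b i \<and> a' i \<le> b' i) \<Longrightarrow>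
      (LINT x:cuboid a b|lborel. LINT y:cuboid a' b'|lborel. monomial n m (ev x y) * (dl (ev x y) j / rho (dl (ev x y)) ^ 3)) =
      box_diff (\<lambda>y1 y2 y3. box_diff (\<lambda>x1 x2 x3. F (ev (x1, x2, x3) (y1, y2, y3))) a b) a' b'"
    using sixfold_integral[of j k l "\<lambda>d. d j / rho d ^ 3", OF kl antiderivable_force_kernel[OF p] cont meas bound, of n m]
    by auto
  \<comment> \<open>At \<open>s = 0\<close> both sides are 0, since
    \<open>0 powr (3 / 2) = 0\<close>, so the two forms of the kernel agree for \<open>x = y\<close>
    as well.\<close>
  have "sqrt s ^ 3 = s powr (3 / 2)" if "0 \<le> s" for s
    using that by (cases "s = 0") (simp_all add: powr_half_sqrt[symmetric] powr_power)
  then have "Fforce j a b a' b' n m =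
      (LINT x:cuboid a b|lborel. LINT y:cuboid a' b'|lborel. monomial n m (ev x y) * (dl (ev x y) j / rho (dl (ev x y)) ^ 3))" for a b a' b'
    by (simp add: Fforce_def monomial_ev rho_dl_ev sqdist3_nonneg ac_simps)
  then show ?thesis
    by (intro vertex_combination_coefficients[OF vertex_combination_sixfold[OF F(1)]])
      (simp only: F(2) less_imp_le)
qed

theorem mainTheorem1:
  fixes n m :: "nat \<Rightarrow> nat"
  shows "(\<exists>coef. (\<forall>k \<sigma> S S'. coef k \<sigma> S S' \<in> qpoly) \<and>
            (\<forall>a b a' b'. (\<forall>i\<in>{1,2,3}. a i < b i \<and> a' i < b' i) \<longrightarrow>
               Vpot a b a' b' n m = lincomb coef a b a' b'))
       \<and> (\<forall>j\<in>{1,2,3::nat}. \<exists>coef. (\<forall>k \<sigma> S S'. coef k \<sigma> S S' \<in> qpoly) \<and>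
            (\<forall>a b a' b'. (\<forall>i\<in>{1,2,3}. a i < b i \<and> a' i < b' i) \<longrightarrow>
               Fforce j a b a' b' n m = lincomb coef a b a' b'))"
  using Vpot_lincomb Fforce_lincomb by blast

end
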